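(* Let $p\ge1$, $\delta_0>0$ and $f\in L^2(\Omega)$ be fixed. For $\delta\in(0,\delta_0)$ let $\rho_\delta\in L^\infty(\Omega_{\delta_0})$, and let $\rho\in L^\infty(\Omega_{\delta_0})$, be such that $\underline\rho\le\rho_\delta(x)\le\overline\rho$ and $\underline\rho\le\rho(x)\le\overline\rho$ for almost all $x\in\Omega_{\delta_0}$. Assume that $\rho_\delta^p\rightharpoonup\rho^p$ weak$^*$ in $L^\infty(\Omega_{\delta_0})$ as $\delta\to0$. Let $u_\delta=\mathcal{S}_\delta(\kappa_\delta)$ be the solution of the non-local state equation with conductivity $\kappa_\delta(x,x')=\rho_\delta^{p/2}(x)\rho_\delta^{p/2}(x')$, and let $u=\mathcal{S}^{\mathrm{loc}}(\rho^p)$ be the solution of the local state equation with conductivity $\rho^p$. Then, for the compliances $\mathfrak{c}_\delta(\rho_\delta)=\ell(u_\delta)$ and $\mathfrak{c}(\rho)=\ell(u)$, $$\liminf_{\delta\to0}\mathfrak{c}_\delta(\rho_\delta)\ge\mathfrak{c}(\rho).$$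
   Context: $\Omega\subset\mathbb{R}^n$, $n\ge2$, is open, bounded and connected. For $\delta>0$, $B(x,\delta)$ is the open ball, and $\Omega_\delta=\bigcup_{x\in\Omega}B(x,\delta)$. Constants $0<\underline\rho<\overline\rho<\infty$ are given. Limits as $\delta\to0$ are understood along arbitrary sequences $\delta_j\to0$. Kernel: for every $\delta>0$, $A_\delta:\mathbb{R}_+\to\mathbb{R}_+$ satisfies $\frac1n\int_{\mathbb{R}^n}A_\delta(|x|)\,dx=1$ and $\operatorname{supp}A_\delta(|\cdot|)\subset B(0,\delta)$, and there exist $s\in(0,1)$ and $c_\delta>0$ such that $A_\delta(|x|)\ge c_\delta|x|^{-(n+2s-2)}$ for all $x\in B(0,\delta/2)\setminus\{0\}$, $\delta>0$. Linear functional: $\ell(v)=\int_\Omega f(x)v(x)\,dx$. Non-local problem: for symmetric $\kappa\in L^\infty(\Omega_\delta\times\Omega_\delta)$ bounded between two positive constants, $$a_{\delta,\kappa}(u,v)=\int_{\Omega_\delta}\int_{\Omega_\delta}\kappa(x,x')A_\delta(|x-x'|)\frac{u(x)-u(x')}{|x-x'|}\frac{v(x)-v(x')}{|x-x'|}\,dx\,dx'.$$ $\mathcal{U}^\delta=\{u\in L^2(\Omega_\delta): a_{\delta,1}(u,u)<\infty\}$; $\mathcal{U}_0^\delta$ is the closure of $C_c^\infty(\Omega)$ (functions extended by $0$ outside $\Omega$) in $\mathcal{U}^\delta$ with respect to the norm $(\|u\|_{L^2(\Omega_\delta)}^2+a_{\delta,1}(u,u))^{1/2}$; its elements vanish a.e.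 outside $\Omega$, and $a_{\delta,1}$ is an inner product making it a Hilbert space. $\mathcal{S}_\delta(\kappa)\in\mathcal{U}_0^\delta$ denotes the unique solution $u$ of the non-local state equation $a_{\delta,\kappa}(u,v)=\ell(v)$ for all $v\in\mathcal{U}_0^\delta$ (a conductivity defined on a larger set is restricted to $\Omega_\delta\times\Omega_\delta$). Local problem: $\mathcal{S}^{\mathrm{loc}}(\rho^p)\in W_0^{1,2}(\Omega)$ denotes the unique solution $u$ of the local state equation $\int_\Omega\rho^p\nabla u\cdot\nabla v\,dx=\ell(v)$ for all $v\in W_0^{1,2}(\Omega)$. *)

theory Defs
  imports "HOL-Analysis.Analysis"
begin

text \<open>
  Elements of Lebesgue and Sobolev spaces are represented by functions on the whole type; only their
  values on the set in question matter, and only up to null sets.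
\<close>

definition nbhd :: "'a::euclidean_space set \<Rightarrow> real \<Rightarrow> 'a set" where
  "nbhd \<Omega> \<delta> = (\<Union>x\<in>\<Omega>. ball x \<delta>)"

definition L2 :: "'a::euclidean_space set \<Rightarrow> ('a \<Rightarrow> 'b::euclidean_space) set" where
  "L2 S = {u \<in> borel_measurable (lebesgue_on S). integrable (lebesgue_on S) (\<lambda>x. (norm (u x))\<^sup>2)}"

definition Linf :: "'a::euclidean_space set \<Rightarrow> ('a \<Rightarrow> real) set" where
  "Linf S = {g \<in> borel_measurable (lebesgue_on S). \<exists>C. AE x in lebesgue_on S. \<bar>g x\<bar> \<le> C}"

definition weak_star_tendsto ::
    "'a::euclidean_space set \<Rightarrow> ('i \<Rightarrow> 'a \<Rightarrow> real) \<Rightarrow> ('a \<Rightarrow> real) \<Rightarrow> 'i filter \<Rightarrow> bool" where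
  "weak_star_tendsto S g h F \<longleftrightarrow>
     (\<forall>\<^sub>F i in F. g i \<in> Linf S) \<and> h \<in> Linf S \<and>
     (\<forall>\<psi>. integrable (lebesgue_on S) \<psi> \<longrightarrow>
        ((\<lambda>i. LINT x|lebesgue_on S. g i x * \<psi> x) \<longlongrightarrow> (LINT x|lebesgue_on S. h x * \<psi> x)) F)"

primrec C_k :: "nat \<Rightarrow> ('a::euclidean_space \<Rightarrow> real) \<Rightarrow> bool" where
  "C_k 0 f \<longleftrightarrow> continuous_on UNIV f"
| "C_k (Suc k) f \<longleftrightarrow> (\<forall>x. f differentiable (at x)) \<and>
     (\<forall>b\<in>Basis. C_k k (\<lambda>x. frechet_derivative f (at x) b))"

definition Cc_infty :: "'a::euclidean_space set \<Rightarrow> ('a \<Rightarrow> real) set" where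
  "Cc_infty \<Omega> = {\<phi>. (\<forall>k. C_k k \<phi>) \<and> compact (closure {x. \<phi> x \<noteq> 0}) \<and> closure {x. \<phi> x \<noteq> 0} \<subseteq> \<Omega>}"

definition load :: "'a::euclidean_space set \<Rightarrow> ('a \<Rightarrow> real) \<Rightarrow> ('a \<Rightarrow> real) \<Rightarrow> real" where
  "load \<Omega> f v = (LINT x|lebesgue_on \<Omega>. f x * v x)"


subsection \<open>Non-local problem\<close>

text \<open>
  The double integral is taken with respect to Lebesgue measure on the product space. The integrand
  vanishes on the diagonal because of \<open>x / 0 = 0\<close>. In the functions below, \<open>A\<close> is the
  kernel for the fixed horizon \<open>\<delta>\<close>.
\<close>

definition nl_integrand ::
    "(real \<Rightarrow> real) \<Rightarrow> ('a \<Rightarrow> 'a \<Rightarrow> real) \<Rightarrow> ('a::euclidean_space \<Rightarrow> real) \<Rightarrow> ('a \<Rightarrow> real) \<Rightarrow> 'a \<times> 'a \<Rightarrow> real" where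
  "nl_integrand A \<kappa> u v = (\<lambda>(x, x'). \<kappa> x x' * A (norm (x - x')) *
     ((u x - u x') / norm (x - x')) * ((v x - v x') / norm (x - x')))"

definition nl_form ::
    "(real \<Rightarrow> real) \<Rightarrow> real \<Rightarrow> 'a::euclidean_space set \<Rightarrow> ('a \<Rightarrow> 'a \<Rightarrow> real) \<Rightarrow> ('a \<Rightarrow> real) \<Rightarrow> ('a \<Rightarrow> real) \<Rightarrow> real" where
  "nl_form A \<delta> \<Omega> \<kappa> u v =
     (LINT z|lebesgue_on (nbhd \<Omega> \<delta> \<times> nbhd \<Omega> \<delta>). nl_integrand A \<kappa> u v z)"

text \<open>
  For \<open>A \<ge> 0\<close> the integrand of the energy is non-negative, so its integrability expresses that the
  energy is finite.
\<close>

definition U_space ::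
    "(real \<Rightarrow> real) \<Rightarrow> real \<Rightarrow> 'a::euclidean_space set \<Rightarrow> ('a \<Rightarrow> real) set" where
  "U_space A \<delta> \<Omega> = {u \<in> L2 (nbhd \<Omega> \<delta>).
     integrable (lebesgue_on (nbhd \<Omega> \<delta> \<times> nbhd \<Omega> \<delta>)) (nl_integrand A (\<lambda>_ _. 1) u u)}"

definition U_norm ::
    "(real \<Rightarrow> real) \<Rightarrow> real \<Rightarrow> 'a::euclidean_space set \<Rightarrow> ('a \<Rightarrow> real) \<Rightarrow> real" where
  "U_norm A \<delta> \<Omega> u =
     sqrt ((LINT x|lebesgue_on (nbhd \<Omega> \<delta>). (u x)\<^sup>2) + nl_form A \<delta> \<Omega> (\<lambda>_ _. 1) u u)"

definition U0_space ::
    "(real \<Rightarrow> real) \<Rightarrow> real \<Rightarrow> 'a::euclidean_space set \<Rightarrow> ('a \<Rightarrow> real) set" where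
  "U0_space A \<delta> \<Omega> = {u \<in> U_space A \<delta> \<Omega>.
     \<forall>\<epsilon>>0. \<exists>\<phi>\<in>Cc_infty \<Omega>. U_norm A \<delta> \<Omega> (\<lambda>x. u x - \<phi> x) < \<epsilon>}"

definition nl_solution ::
    "(real \<Rightarrow> real) \<Rightarrow> real \<Rightarrow> 'a::euclidean_space set \<Rightarrow> ('a \<Rightarrow> real) \<Rightarrow> ('a \<Rightarrow> 'a \<Rightarrow> real) \<Rightarrow> ('a \<Rightarrow> real) \<Rightarrow> bool" where
  "nl_solution A \<delta> \<Omega> f \<kappa> u \<longleftrightarrow>
     u \<in> U0_space A \<delta> \<Omega> \<and> (\<forall>v\<in>U0_space A \<delta> \<Omega>. nl_form A \<delta> \<Omega> \<kappa> u v = load \<Omega> f v)"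


subsection \<open>Local problem\<close>

definition has_weak_gradient ::
    "'a::euclidean_space set \<Rightarrow> ('a \<Rightarrow> real) \<Rightarrow> ('a \<Rightarrow> 'a) \<Rightarrow> bool" where
  "has_weak_gradient \<Omega> u G \<longleftrightarrow> G \<in> L2 \<Omega> \<and>
     (\<forall>\<phi>\<in>Cc_infty \<Omega>. \<forall>b\<in>Basis.
        (LINT x|lebesgue_on \<Omega>. u x * frechet_derivative \<phi> (at x) b) =
        - (LINT x|lebesgue_on \<Omega>. (G x \<bullet> b) * \<phi> x))"

definition W12 :: "'a::euclidean_space set \<Rightarrow> ('a \<Rightarrow> real) set" where
  "W12 \<Omega> = {u \<in> L2 \<Omega>. \<exists>G. has_weak_gradient \<Omega> u G}"

text \<open>Closure of the test functions in \<open>W\<^sup>1\<^sup>,\<^sup>2\<close>; \<open>G\<close> is the weak gradient of \<open>u - \<phi>\<close>.\<close>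

definition W12_0 :: "'a::euclidean_space set \<Rightarrow> ('a \<Rightarrow> real) set" where
  "W12_0 \<Omega> = {u \<in> W12 \<Omega>. \<forall>\<epsilon>>0. \<exists>\<phi>\<in>Cc_infty \<Omega>. \<exists>G.
     has_weak_gradient \<Omega> (\<lambda>x. u x - \<phi> x) G \<and>
     sqrt ((LINT x|lebesgue_on \<Omega>. (u x - \<phi> x)\<^sup>2) + (LINT x|lebesgue_on \<Omega>. (norm (G x))\<^sup>2)) < \<epsilon>}"

text \<open>
  Weak gradients are unique up to null sets, so the quantification over \<open>G\<close> and \<open>H\<close> below merely
  ranges over the representatives of the gradients of \<open>u\<close> and \<open>v\<close>.
\<close>

definition loc_solution ::
    "'a::euclidean_space set \<Rightarrow> ('a \<Rightarrow> real) \<Rightarrow> ('a \<Rightarrow> real) \<Rightarrow> ('a \<Rightarrow> real) \<Rightarrow> bool" where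
  "loc_solution \<Omega> f \<sigma> u \<longleftrightarrow> u \<in> W12_0 \<Omega> \<and>
     (\<forall>v\<in>W12_0 \<Omega>. \<forall>G H. has_weak_gradient \<Omega> u G \<longrightarrow> has_weak_gradient \<Omega> v H \<longrightarrow>
        (LINT x|lebesgue_on \<Omega>. \<sigma> x * (G x \<bullet> H x)) = load \<Omega> f v)"

end

theory Submission
  imports Defs
begin

text \<open>
  Both compliances are maxima of concave functionals: testing the state equations with the solutions
  shows that the non-local compliance is at least
  \<open>2 \<ell>(\<phi>) - a\<^sub>\<delta>(\<phi>, \<phi>)\<close> for every test function \<open>\<phi>\<close> (\<open>nl_compliance_ge\<close>), while
  \<open>2 \<ell>(\<phi>) - \<integral> \<rho>\<^sup>p |\<nabla>\<phi>|\<^sup>2\<close> comes arbitrarily close to the local compliance as \<open>\<phi>\<close> varies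
  (\<open>local_compliance_approx\<close>). A lower bound for the limit inferior therefore only needs an upper
  bound for the energies of one fixed smooth \<open>\<phi>\<close>.

  The conductivity enters that energy as a product \<open>\<gamma>(x) \<gamma>(x')\<close> with
  \<open>\<gamma> = \<rho>\<^sub>\<delta>\<^bsup>p/2\<^esup>\<close>, and products do not pass to weak* limits. The inequality
  \<open>\<gamma>(x) \<gamma>(x') \<le> (\<gamma>(x)\<^sup>2 + \<gamma>(x')\<^sup>2) / 2\<close> replaces it by a sum whose terms are linear in
  \<open>\<gamma>\<^sup>2 = \<rho>\<^sub>\<delta>\<^sup>p\<close>; it points in the right direction for an upper bound. Within the
  horizon, the difference quotient of \<open>\<phi>\<close> is that of its linearisation up to a small \<open>\<epsilon>\<close>,
  uniformly in the base point (\<open>Cc_infty_quadratic_bound\<close>). Integrating a radial kernel of mass \<open>n\<close>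
  against \<open>(w \<bullet> h / |h|)\<^sup>2\<close> gives \<open>|w|\<^sup>2\<close> (\<open>radial_second_moments\<close>), so by Fubini the
  energy is at most \<open>\<integral> \<rho>\<^sub>\<delta>\<^sup>p (|\<nabla>\<phi>|\<^sup>2 + n \<epsilon>)\<close> (\<open>nl_form_le_local\<close>). This
  expression is linear in \<open>\<rho>\<^sub>\<delta>\<^sup>p\<close>, and weak* convergence tested with \<open>|\<nabla>\<phi>|\<^sup>2\<close>
  finishes the proof.
\<close>

section \<open>Null sets and Fubini's theorem on the product space\<close>

lemma distr_lborel_reflect:
  fixes x :: "'a::euclidean_space"
  shows "distr lborel borel (\<lambda>y. x - y) = lborel"
  by (subst (2) lborel_affine[of "-1" x]) (auto simp: density_1)

text \<open>
  Lebesgue-measurable functions compose well only with maps that pull null sets back to null sets.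
  The maps needed are \<open>(x, y) \<mapsto> x\<close>, \<open>(x, y) \<mapsto> y\<close> and \<open>(x, y) \<mapsto> x - y\<close>, which carry
  conductivities, functions and the kernel to the product space.
\<close>

lemma measurable_lebesgue_pullback:
  fixes T :: "'b::euclidean_space \<Rightarrow> 'a::euclidean_space"
  assumes T: "T \<in> borel_measurable borel"
    and null: "\<And>N. N \<in> null_sets lborel \<Longrightarrow> AE z in lborel. T z \<notin> N"
  shows "T \<in> lebesgue \<rightarrow>\<^sub>M lebesgue"
proof (rule completion.measurable_completion2)
  show T': "T \<in> lebesgue \<rightarrow>\<^sub>M lborel"
    using T by (simp add: measurable_completion)
  show "null_sets lborel \<subseteq> null_sets (distr lebesgue lborel T)"
  proof
    fix N :: "'a set" assume N: "N \<in> null_sets lborel"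
    then have "AE z in lebesgue. T z \<notin> N"
      using null AE_completion by blast
    then have "T -` N \<inter> space lebesgue \<in> null_sets lebesgue"
      using measurable_sets[OF T', of N] N by (subst AE_iff_null_sets) (auto simp: null_sets_def)
    then show "N \<in> null_sets (distr lebesgue lborel T)"
      using N T' by (auto simp: null_sets_def emeasure_distr)
  qed
qed

lemma AE_lebesgue_pullback:
  fixes T :: "'b::euclidean_space \<Rightarrow> 'a::euclidean_space"
  assumes null: "\<And>N. N \<in> null_sets lborel \<Longrightarrow> AE z in lborel. T z \<notin> N"
    and P: "AE y in lebesgue. P y"
  shows "AE z in lebesgue. P (T z)"
proof -
  from P have "AE y in lborel. P y" by (simp add: AE_completion_iff)
  then obtain N where N: "N \<in> null_sets lborel" "{y. \<not> P y} \<subseteq> N"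
    by (auto elim!: AE_E simp: null_sets_def)
  show ?thesis
    using AE_completion[OF null[OF N(1)]] by eventually_elim (use N(2) in auto)
qed

text \<open>
  Almost every section of the preimage of a null set under one of the three maps is null, so the
  preimage is null by Fubini's theorem.
\<close>

lemma null_set_pullbacks:
  fixes N :: "'a::euclidean_space set"
  assumes "N \<in> null_sets lborel"
  shows AE_fst_notin: "AE z in lborel. fst (z::'a \<times> 'a) \<notin> N"
    and AE_snd_notin: "AE z in lborel. snd (z::'a \<times> 'a) \<notin> N"
    and AE_diff_notin: "AE z in lborel. fst (z::'a \<times> 'a) - snd z \<notin> N"
proof -
  have [measurable]: "N \<in> sets borel" using assms by (auto simp: null_sets_def)
  have N: "AE y in lborel. y \<notin> N" using assms by (rule AE_not_in)
  have N': "AE y in lborel. x - y \<notin> N" for x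
  proof -
    have "AE y in distr lborel borel (\<lambda>y. x - y). y \<notin> N"
      unfolding distr_lborel_reflect by (rule N)
    then show ?thesis by (subst (asm) AE_distr_iff) auto
  qed
  show "AE z in lborel. fst (z::'a \<times> 'a) \<notin> N"
    unfolding lborel_prod[symmetric]
    by (rule lborel_pair.AE_pair_measure, measurable) (use N in \<open>eventually_elim, simp\<close>)
  show "AE z in lborel. snd (z::'a \<times> 'a) \<notin> N"
    unfolding lborel_prod[symmetric]
    by (rule lborel_pair.AE_pair_measure, measurable) (use N in auto)
  show "AE z in lborel. fst (z::'a \<times> 'a) - snd z \<notin> N"
    unfolding lborel_prod[symmetric]
    by (rule lborel_pair.AE_pair_measure, measurable) (use N' in auto)
qed

lemma measurable_lebesgue_proj:
  shows measurable_lebesgue_fst: "fst \<in> (lebesgue :: ('a::euclidean_space \<times> 'a) measure) \<rightarrow>\<^sub>M lebesgue"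
    and measurable_lebesgue_snd: "snd \<in> (lebesgue :: ('a::euclidean_space \<times> 'a) measure) \<rightarrow>\<^sub>M lebesgue"
    and measurable_lebesgue_diff: "(\<lambda>z. fst z - snd z) \<in> (lebesgue :: ('a::euclidean_space \<times> 'a) measure) \<rightarrow>\<^sub>M lebesgue"
  by (rule measurable_lebesgue_pullback; (intro AE_fst_notin AE_snd_notin AE_diff_notin)?;
      simp add: borel_prod[symmetric])+

text \<open>
  The increment \<open>h = x - y\<close> replaces one of the two variables; either one may be kept. In the second
  version \<open>h\<close> is the negative of the increment seen from the base point, which is harmless for
  integrands that are even in \<open>h\<close>, and lets both versions evaluate the kernel at the same point.
\<close>

lemma nn_integral_shear:
  fixes F :: "'a::euclidean_space \<times> 'a \<Rightarrow> ennreal"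
  assumes [measurable]: "F \<in> borel_measurable borel"
  shows nn_integral_shear_fst:
      "(\<integral>\<^sup>+z. F (fst z, fst z - snd z) \<partial>lborel) = (\<integral>\<^sup>+x. \<integral>\<^sup>+h. F (x, h) \<partial>lborel \<partial>lborel)"
    and nn_integral_shear_snd:
      "(\<integral>\<^sup>+z. F (snd z, fst z - snd z) \<partial>lborel) = (\<integral>\<^sup>+x. \<integral>\<^sup>+h. F (x, h) \<partial>lborel \<partial>lborel)"
proof -
  have [measurable]: "F \<in> borel_measurable (borel \<Otimes>\<^sub>M borel)" by (simp add: borel_prod)
  have inner1: "(\<integral>\<^sup>+y. F (x, x - y) \<partial>lborel) = (\<integral>\<^sup>+h. F (x, h) \<partial>lborel)" for x
    by (subst (2) distr_lborel_reflect[of x, symmetric], subst nn_integral_distr) auto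
  have inner2: "(\<integral>\<^sup>+y. F (x, y - x) \<partial>lborel) = (\<integral>\<^sup>+h. F (x, h) \<partial>lborel)" for x
    by (subst (2) lborel_distr_plus[of "- x", symmetric], subst nn_integral_distr) auto
  show "(\<integral>\<^sup>+z. F (fst z, fst z - snd z) \<partial>lborel) = (\<integral>\<^sup>+x. \<integral>\<^sup>+h. F (x, h) \<partial>lborel \<partial>lborel)"
    unfolding lborel_prod[symmetric] inner1[symmetric]
    by (subst lborel.nn_integral_fst[symmetric]) auto
  show "(\<integral>\<^sup>+z. F (snd z, fst z - snd z) \<partial>lborel) = (\<integral>\<^sup>+x. \<integral>\<^sup>+h. F (x, h) \<partial>lborel \<partial>lborel)"
    unfolding lborel_prod[symmetric] inner2[symmetric]
    by (subst lborel_pair.nn_integral_snd[symmetric]) auto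
qed

section \<open>Second moments of radial kernels\<close>

lemma distr_lebesgue:
  fixes T :: "'a::euclidean_space \<Rightarrow> 'a"
  assumes T: "T \<in> borel_measurable borel" and inv: "distr lborel borel T = lborel"
  shows "distr lebesgue lebesgue T = lebesgue" and "T \<in> lebesgue \<rightarrow>\<^sub>M lebesgue"
proof -
  have T': "T \<in> lborel \<rightarrow>\<^sub>M lborel" using T by simp
  have eq: "distr lebesgue lborel T = lborel"
    using distr_completion[OF T'] inv by (simp cong: distr_cong)
  show "distr lebesgue lebesgue T = lebesgue"
    using completion.completion_distr_eq[OF measurable_completion[OF T']] by (simp add: eq)
  show "T \<in> lebesgue \<rightarrow>\<^sub>M lebesgue"
    using completion.measurable_completion2[OF measurable_completion[OF T']] by (simp add: eq)
qed

text \<open>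
  Invariance under sign changes and transpositions of coordinates suffices for the second moments:
  the former kill the mixed moments, the latter equate the pure ones.
\<close>

definition flip_coord :: "'a::euclidean_space \<Rightarrow> 'a \<Rightarrow> 'a" where
  "flip_coord b x = (\<Sum>i\<in>Basis. ((if i = b then - 1 else 1) * (x \<bullet> i)) *\<^sub>R i)"

definition swap_coords :: "'a::euclidean_space \<Rightarrow> 'a \<Rightarrow> 'a \<Rightarrow> 'a" where
  "swap_coords b c x = (\<Sum>i\<in>Basis. (x \<bullet> Transposition.transpose b c i) *\<^sub>R i)"

lemma inner_flip_coord:
  "i \<in> Basis \<Longrightarrow> flip_coord b x \<bullet> i = (if i = b then - 1 else 1) * (x \<bullet> i)"
  by (simp add: flip_coord_def)

lemma inner_swap_coords:
  "i \<in> Basis \<Longrightarrow> swap_coords b c x \<bullet> i = x \<bullet> Transposition.transpose b c i"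
  by (simp add: swap_coords_def)

lemma norm_flip_coord: "norm (flip_coord b x) = norm x"
  by (simp add: norm_eq_sqrt_inner euclidean_inner[of _ "flip_coord b x"] euclidean_inner[of _ x]
      inner_flip_coord if_distrib cong: if_cong) (auto intro!: sum.cong)

lemma norm_swap_coords:
  assumes "b \<in> Basis" "c \<in> Basis"
  shows "norm (swap_coords b c x) = norm x"
proof -
  have "(\<Sum>i\<in>Basis. (x \<bullet> Transposition.transpose b c i)\<^sup>2) = (\<Sum>i\<in>Basis. (x \<bullet> i)\<^sup>2)"
    using assms by (intro sum.reindex_bij_betw[of _ _ _ "\<lambda>i. (x \<bullet> i)\<^sup>2"]) simp
  then show ?thesis
    by (simp add: norm_eq_sqrt_inner euclidean_inner[of _ "swap_coords b c x"] euclidean_inner[of _ x]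
        inner_swap_coords power2_eq_square)
qed

lemma distr_flip_coord: "distr lborel borel (flip_coord b) = (lborel :: 'a::euclidean_space measure)"
proof -
  have "lborel = density (distr lborel borel
      (\<lambda>x::'a. 0 + (\<Sum>j\<in>Basis. ((if j = b then - 1 else 1) * (x \<bullet> j)) *\<^sub>R j)))
      (\<lambda>_. ennreal (\<Prod>j\<in>Basis. \<bar>if j = b then - 1 else 1\<bar>))"
    using lborel_affine_euclidean[of "\<lambda>i. if i = b then - 1 else 1" "0::'a"] by simp
  also have "(\<Prod>j\<in>Basis. \<bar>if j = b then - 1 else 1 :: real\<bar>) = 1"
    by (intro prod.neutral) auto
  finally show ?thesis
    by (simp add: density_1 flip_coord_def[abs_def])
qed

lemma distr_swap_coords:
  fixes b c :: "'a::euclidean_space"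
  assumes bc: "b \<in> Basis" "c \<in> Basis"
  shows "distr lborel borel (swap_coords b c) = lborel"
proof (rule lborel_eqI[symmetric])
  have [measurable]: "swap_coords b c \<in> borel_measurable borel"
    by (simp add: swap_coords_def[abs_def])
  let ?t = "Transposition.transpose b c"
  have tB: "?t i \<in> Basis \<longleftrightarrow> i \<in> Basis" for i
    using bc by (auto simp: Transposition.transpose_def)
  have bij: "bij_betw ?t Basis Basis" using bc by simp
  fix l u :: 'a assume le: "\<And>b. b \<in> Basis \<Longrightarrow> l \<bullet> b \<le> u \<bullet> b"
  have "swap_coords b c -` box l u = box (swap_coords b c l) (swap_coords b c u)"
  proof (intro set_eqI iffI)
    fix x assume "x \<in> swap_coords b c -` box l u"
    then have "l \<bullet> ?t i < x \<bullet> i \<and> x \<bullet> i < u \<bullet> ?t i" if "i \<in> Basis" for i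
      using that tB[of i] by (auto simp: mem_box inner_swap_coords dest!: bspec[of _ _ "?t i"])
    then show "x \<in> box (swap_coords b c l) (swap_coords b c u)"
      by (auto simp: mem_box inner_swap_coords)
  next
    fix x assume x: "x \<in> box (swap_coords b c l) (swap_coords b c u)"
    have "l \<bullet> i < x \<bullet> ?t i \<and> x \<bullet> ?t i < u \<bullet> i" if "i \<in> Basis" for i
      using x that tB[of i] by (auto simp: mem_box inner_swap_coords dest!: bspec[of _ _ "?t i"])
    then show "x \<in> swap_coords b c -` box l u"
      by (auto simp: mem_box inner_swap_coords)
  qed
  then have "emeasure (distr lborel borel (swap_coords b c)) (box l u)
      = emeasure lborel (box (swap_coords b c l) (swap_coords b c u))"
    by (simp add: emeasure_distr)
  also have "\<dots> = (\<Prod>i\<in>Basis. (u - l) \<bullet> ?t i)"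
    using le tB by (simp add: emeasure_lborel_box_eq inner_swap_coords inner_diff_left)
  also have "(\<Prod>i\<in>Basis. (u - l) \<bullet> ?t i) = (\<Prod>i\<in>Basis. (u - l) \<bullet> i)"
    by (rule prod.reindex_bij_betw[OF bij])
  finally show "emeasure (distr lborel borel (swap_coords b c)) (box l u) = (\<Prod>i\<in>Basis. (u - l) \<bullet> i)" .
qed simp

text \<open>
  The matrix of second moments \<open>\<integral> k(|h|) h\<^sub>i h\<^sub>j / |h|\<^sup>2 dh\<close> commutes with the symmetries
  above, hence is a multiple of the identity, and its trace is \<open>\<integral> k(|h|) dh\<close>.
\<close>

lemma radial_second_moments:
  fixes k :: "real \<Rightarrow> real" and w :: "'a::euclidean_space"
  assumes k: "integrable lebesgue (\<lambda>x::'a. k (norm x))"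
  shows "integrable lebesgue (\<lambda>h. k (norm h) * (w \<bullet> h / norm h)\<^sup>2)" (is ?int)
    and "(LINT h|lebesgue. k (norm h) * (w \<bullet> h / norm h)\<^sup>2)
       = (norm w)\<^sup>2 / DIM('a) * (LINT x::'a|lebesgue. k (norm x))" (is ?eq)
proof -
  define q where "q i j h = k (norm h) * ((h \<bullet> i) * (h \<bullet> j) / (norm h)\<^sup>2)" for i j h :: 'a
  have [measurable]: "(\<lambda>x::'a. k (norm x)) \<in> borel_measurable lebesgue"
    using k by auto
  have [measurable]: "(\<lambda>h::'a. (h \<bullet> i) * (h \<bullet> j) / (norm h)\<^sup>2) \<in> borel_measurable lebesgue" for i j
    by (rule measurable_completion) auto
  have int_q: "integrable lebesgue (q i j)" if "i \<in> Basis" "j \<in> Basis" for i j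
  proof (rule Bochner_Integration.integrable_bound[OF k])
    show "q i j \<in> borel_measurable lebesgue" unfolding q_def by measurable
    have le1: "\<bar>(h \<bullet> i) * (h \<bullet> j) / (norm h)\<^sup>2\<bar> \<le> 1" for h
    proof -
      have "\<bar>h \<bullet> i\<bar> * \<bar>h \<bullet> j\<bar> \<le> norm h * norm h"
        using that by (intro mult_mono Basis_le_norm) auto
      then show ?thesis
        by (cases "h = 0") (simp_all add: abs_mult power2_eq_square)
    qed
    have "norm (q i j h) \<le> norm (k (norm h))" for h
    proof -
      have "norm (q i j h) = \<bar>k (norm h)\<bar> * \<bar>(h \<bullet> i) * (h \<bullet> j) / (norm h)\<^sup>2\<bar>"
        unfolding q_def by (simp only: abs_mult real_norm_def)
      also have "\<dots> \<le> \<bar>k (norm h)\<bar>" by (rule mult_left_le[OF le1 abs_ge_zero])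
      finally show ?thesis by simp
    qed
    then show "AE h in lebesgue. norm (q i j h) \<le> norm (k (norm h))" by simp
  qed
  have off: "integral\<^sup>L lebesgue (q i j) = 0" if ij: "i \<in> Basis" "j \<in> Basis" "i \<noteq> j" for i j
  proof -
    have [measurable]: "flip_coord i \<in> borel_measurable borel"
      by (simp add: flip_coord_def[abs_def])
    note T = distr_lebesgue[OF this distr_flip_coord]
    have "integral\<^sup>L lebesgue (q i j) = integral\<^sup>L (distr lebesgue lebesgue (flip_coord i)) (q i j)"
      by (simp add: T)
    also have "\<dots> = (LINT h|lebesgue. q i j (flip_coord i h))"
      using int_q[OF ij(1,2)] by (intro integral_distr T) auto
    also have "\<dots> = (LINT h|lebesgue. - q i j h)"
      using ij by (simp add: q_def norm_flip_coord inner_flip_coord)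
    finally show ?thesis by simp
  qed
  have diag: "integral\<^sup>L lebesgue (q i i) = integral\<^sup>L lebesgue (q j j)" if ij: "i \<in> Basis" "j \<in> Basis" for i j
  proof -
    have [measurable]: "swap_coords i j \<in> borel_measurable borel"
      by (simp add: swap_coords_def[abs_def])
    note T = distr_lebesgue[OF this distr_swap_coords[OF ij]]
    have "integral\<^sup>L lebesgue (q i i) = integral\<^sup>L (distr lebesgue lebesgue (swap_coords i j)) (q i i)"
      by (simp add: T)
    also have "\<dots> = (LINT h|lebesgue. q i i (swap_coords i j h))"
      using int_q[OF ij(1,1)] by (intro integral_distr T) auto
    also have "\<dots> = (LINT h|lebesgue. q j j h)"
      using ij by (simp add: q_def norm_swap_coords inner_swap_coords)
    finally show ?thesis by simp
  qed
  have ae0: "AE h in lebesgue. h \<noteq> (0::'a)"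
    by (intro AE_completion AE_lborel_singleton)
  have trace: "(\<Sum>i\<in>Basis. integral\<^sup>L lebesgue (q i i)) = (LINT x::'a|lebesgue. k (norm x))"
  proof -
    have "(\<Sum>i\<in>Basis. integral\<^sup>L lebesgue (q i i)) = (LINT h|lebesgue. (\<Sum>i\<in>Basis. q i i h))"
      using int_q by (intro Bochner_Integration.integral_sum[symmetric]) auto
    also have "\<dots> = (LINT x::'a|lebesgue. k (norm x))"
    proof (rule integral_cong_AE)
      show "(\<lambda>h. \<Sum>i\<in>Basis. q i i h) \<in> borel_measurable lebesgue"
        using int_q by (intro borel_measurable_sum) auto
      have "(\<Sum>i\<in>Basis. q i i h) = k (norm h)" if "h \<noteq> 0" for h
      proof -
        have "(\<Sum>i\<in>Basis. (h \<bullet> i) * (h \<bullet> i)) = (norm h)\<^sup>2"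
          unfolding power2_norm_eq_inner by (rule euclidean_inner[symmetric])
        then show ?thesis
          using that unfolding q_def sum_distrib_left[symmetric] sum_divide_distrib[symmetric] by simp
      qed
      then show "AE h in lebesgue. (\<Sum>i\<in>Basis. q i i h) = k (norm h)"
        using ae0 by auto
    qed simp
    finally show ?thesis .
  qed
  have diag_val: "integral\<^sup>L lebesgue (q i i) = (LINT x::'a|lebesgue. k (norm x)) / DIM('a)" if "i \<in> Basis" for i
  proof -
    have "(\<Sum>j\<in>Basis. integral\<^sup>L lebesgue (q j j)) = (\<Sum>j\<in>(Basis::'a set). integral\<^sup>L lebesgue (q i i))"
      by (rule sum.cong[OF refl diag[OF _ that]])
    then show ?thesis using trace by (simp add: field_simps)
  qed
  have expand: "k (norm h) * (w \<bullet> h / norm h)\<^sup>2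
      = (\<Sum>i\<in>Basis. \<Sum>j\<in>Basis. (w \<bullet> i) * (w \<bullet> j) * q i j h)" for h
  proof -
    have "(w \<bullet> h)\<^sup>2 = (\<Sum>i\<in>Basis. \<Sum>j\<in>Basis. ((w \<bullet> i) * (h \<bullet> i)) * ((w \<bullet> j) * (h \<bullet> j)))"
      unfolding power2_eq_square euclidean_inner[of w h] sum_product ..
    then have "k (norm h) * (w \<bullet> h / norm h)\<^sup>2
        = k (norm h) * ((\<Sum>i\<in>Basis. \<Sum>j\<in>Basis. ((w \<bullet> i) * (h \<bullet> i)) * ((w \<bullet> j) * (h \<bullet> j))) / (norm h)\<^sup>2)"
      by (simp only: power_divide)
    also have "\<dots> = (\<Sum>i\<in>Basis. \<Sum>j\<in>Basis. (w \<bullet> i) * (w \<bullet> j) * q i j h)"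
      unfolding sum_distrib_left sum_divide_distrib q_def
      by (intro sum.cong refl) (simp add: mult_ac)
    finally show ?thesis .
  qed
  show ?int unfolding expand
    using int_q by (intro Bochner_Integration.integrable_sum integrable_mult_right) auto
  have "(LINT h|lebesgue. k (norm h) * (w \<bullet> h / norm h)\<^sup>2)
      = (\<Sum>i\<in>Basis. \<Sum>j\<in>Basis. (w \<bullet> i) * (w \<bullet> j) * integral\<^sup>L lebesgue (q i j))"
    unfolding expand by (simp add: int_q cong: sum.cong)
  also have "\<dots> = (\<Sum>i\<in>Basis. \<Sum>j\<in>Basis. if j = i then (w \<bullet> i)\<^sup>2 * ((LINT x::'a|lebesgue. k (norm x)) / DIM('a)) else 0)"
    using off diag_val by (intro sum.cong refl) (auto simp: power2_eq_square)
  also have "\<dots> = (norm w)\<^sup>2 * ((LINT x::'a|lebesgue. k (norm x)) / DIM('a))"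
  proof -
    have "(\<Sum>i\<in>Basis. (w \<bullet> i)\<^sup>2) = (norm w)\<^sup>2"
      by (simp only: power2_norm_eq_inner euclidean_inner[of w w]) (simp only: power2_eq_square)
    then show ?thesis by (simp add: sum_distrib_right[symmetric] sum_divide_distrib[symmetric])
  qed
  finally show ?eq by simp
qed

section \<open>Test functions\<close>

definition grad :: "('a::euclidean_space \<Rightarrow> real) \<Rightarrow> 'a \<Rightarrow> 'a" where
  "grad F x = (\<Sum>b\<in>Basis. frechet_derivative F (at x) b *\<^sub>R b)"

lemma Cc_infty_has_derivative:
  assumes "\<phi> \<in> Cc_infty \<Omega>"
  shows "(\<phi> has_derivative (\<lambda>h. grad \<phi> x \<bullet> h)) (at x)"
proof -
  have "C_k (Suc 0) \<phi>" using assms unfolding Cc_infty_def by blast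
  then have D: "(\<phi> has_derivative frechet_derivative \<phi> (at x)) (at x)"
    by (simp add: frechet_derivative_works)
  interpret linear "frechet_derivative \<phi> (at x)"
    using has_derivative_linear[OF D] .
  have "frechet_derivative \<phi> (at x) h = grad \<phi> x \<bullet> h" for h
  proof -
    have "frechet_derivative \<phi> (at x) h = frechet_derivative \<phi> (at x) (\<Sum>b\<in>Basis. (h \<bullet> b) *\<^sub>R b)"
      by (simp add: euclidean_representation)
    also have "\<dots> = grad \<phi> x \<bullet> h"
      unfolding sum scale grad_def inner_sum_left inner_scaleR_left by (intro sum.cong refl) (simp add: inner_commute)
    finally show ?thesis .
  qed
  then have "frechet_derivative \<phi> (at x) = (\<lambda>h. grad \<phi> x \<bullet> h)" by (rule ext)
  then show ?thesis using D by simp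
qed

lemma frechet_derivative_Cc_infty:
  assumes "\<phi> \<in> Cc_infty \<Omega>"
  shows "frechet_derivative \<phi> (at x) h = grad \<phi> x \<bullet> h"
  by (simp add: frechet_derivative_at[OF Cc_infty_has_derivative[OF assms], symmetric])

lemma continuous_grad:
  assumes "\<phi> \<in> Cc_infty \<Omega>"
  shows "continuous_on UNIV (grad \<phi>)"
proof -
  have "C_k (Suc 0) \<phi>" using assms unfolding Cc_infty_def by blast
  then show ?thesis
    unfolding grad_def[abs_def] by (intro continuous_intros) auto
qed

lemma continuous_Cc_infty:
  assumes "\<phi> \<in> Cc_infty \<Omega>"
  shows "continuous_on UNIV \<phi>"
proof -
  have "C_k 0 \<phi>" using assms unfolding Cc_infty_def by blast
  then show ?thesis by simp
qed

lemma Cc_infty_support: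
  assumes "\<phi> \<in> Cc_infty \<Omega>"
  obtains K where "compact K" "K \<subseteq> \<Omega>" "\<And>x. x \<notin> K \<Longrightarrow> \<phi> x = 0" "\<And>x. x \<notin> K \<Longrightarrow> grad \<phi> x = 0"
proof
  define K where "K = closure {x. \<phi> x \<noteq> 0}"
  show "compact K" "K \<subseteq> \<Omega>" using assms unfolding Cc_infty_def K_def by blast+
  show zero: "\<phi> x = 0" if "x \<notin> K" for x
    using that closure_subset[of "{x. \<phi> x \<noteq> 0}"] by (auto simp: K_def)
  show "grad \<phi> x = 0" if "x \<notin> K" for x
  proof -
    have "open (- K)" by (simp add: K_def open_Compl)
    then have "((\<lambda>_. 0) has_derivative (\<lambda>h. grad \<phi> x \<bullet> h)) (at x)"
      using has_derivative_transform_within_open[OF Cc_infty_has_derivative[OF assms], of "- K" x "\<lambda>_. 0"]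
        zero that by auto
    then have "(\<lambda>h. grad \<phi> x \<bullet> h) = (\<lambda>h. 0)"
      by (rule has_derivative_unique) simp
    then have "grad \<phi> x \<bullet> grad \<phi> x = 0" by (rule fun_cong)
    then show ?thesis by simp
  qed
qed

lemma bounded_of_compact_support:
  fixes w :: "'a::euclidean_space \<Rightarrow> 'b::real_normed_vector"
  assumes "continuous_on UNIV w" "compact K" "\<And>x. x \<notin> K \<Longrightarrow> w x = 0"
  obtains L where "L \<ge> 0" "\<And>x. norm (w x) \<le> L"
proof -
  have "bounded (w ` K)"
    by (intro compact_imp_bounded compact_continuous_image continuous_on_subset[OF assms(1)] assms(2)) auto
  then obtain B where B: "\<And>x. x \<in> K \<Longrightarrow> norm (w x) \<le> B" by (auto simp: bounded_iff)
  have "norm (w x) \<le> max B 0" for x using B[of x] assms(3)[of x] by (cases "x \<in> K") auto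
  then show ?thesis using that[of "max B 0"] by auto
qed

lemma uniformly_continuous_of_compact_support:
  fixes w :: "'a::euclidean_space \<Rightarrow> 'b::real_normed_vector"
  assumes cont: "continuous_on UNIV w" and K: "compact K" "\<And>x. x \<notin> K \<Longrightarrow> w x = 0"
  shows "uniformly_continuous_on UNIV w"
proof -
  obtain R where R: "K \<subseteq> cball 0 R"
    using compact_imp_bounded[OF K(1)] bounded_subset_ballD[of K 0] ball_subset_cball by blast
  have uc: "uniformly_continuous_on (cball 0 (R + 1)) w"
    using cont by (intro compact_uniformly_continuous) (auto intro: continuous_on_subset)
  show ?thesis
    unfolding uniformly_continuous_on_def
  proof (intro allI impI)
    fix e :: real assume e: "e > 0"
    then obtain d where d: "d > 0"
      "\<And>x y. x \<in> cball 0 (R+1) \<Longrightarrow> y \<in> cball 0 (R+1) \<Longrightarrow> dist y x < d \<Longrightarrow> dist (w y) (w x) < e"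
      using uc unfolding uniformly_continuous_on_def by blast
    have "dist (w y) (w x) < e" if "dist y x < min d 1" for x y
    proof (cases "x \<in> K \<or> y \<in> K")
      case True
      have xy: "norm x \<le> norm y + dist y x" "norm y \<le> norm x + dist y x"
        using norm_triangle_ineq2[of x y] norm_triangle_ineq2[of y x]
        by (auto simp: dist_norm norm_minus_commute)
      have "norm x \<le> R \<or> norm y \<le> R" using True R by auto
      then have "norm x \<le> R + 1" "norm y \<le> R + 1" using xy that by auto
      then show ?thesis using d(2)[of x y] that by auto
    next
      case False then show ?thesis using K(2) e by simp
    qed
    then show "\<exists>d>0. \<forall>x\<in>UNIV. \<forall>x'\<in>UNIV. dist x' x < d \<longrightarrow> dist (w x') (w x) < e"
      using d(1) by (intro exI[of _ "min d 1"]) auto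
  qed
qed

text \<open>
  With \<open>v\<close> the gradient at \<open>x\<close> this is Taylor's formula of first order; with \<open>v = 0\<close> it is the
  Lipschitz estimate.
\<close>

lemma Taylor_bound:
  fixes F :: "'a::euclidean_space \<Rightarrow> real"
  assumes der: "\<And>x. (F has_derivative (\<lambda>h. G x \<bullet> h)) (at x)"
    and G: "\<And>y. norm (y - x) \<le> norm (z - x) \<Longrightarrow> norm (G y - v) \<le> B"
  shows "\<bar>F z - F x - v \<bullet> (z - x)\<bar> \<le> B * norm (z - x)"
proof -
  define g where "g y = F y - v \<bullet> y" for y
  have g: "(g has_derivative (\<lambda>h. (G y - v) \<bullet> h)) (at y within S)" for y S
    unfolding g_def[abs_def] inner_diff_left
    by (intro has_derivative_diff has_derivative_at_withinI[OF der] derivative_eq_intros) auto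
  have "norm (g z - g x) \<le> B * norm (z - x)"
  proof (rule differentiable_bound[of "cball x (norm (z - x))" g])
    show "onorm (\<lambda>h. (G y - v) \<bullet> h) \<le> B" if "y \<in> cball x (norm (z - x))" for y
    proof -
      have "norm (G y - v) \<le> B" using G[of y] that by (simp add: dist_norm norm_minus_commute)
      then have "norm ((G y - v) \<bullet> h) \<le> B * norm h" for h
        using Cauchy_Schwarz_ineq2[of "G y - v" h] by (simp add: mult_right_mono order_trans)
      then show ?thesis by (rule onorm_le)
    qed
  qed (use g in \<open>auto simp: dist_norm norm_minus_commute\<close>)
  then show ?thesis by (simp add: g_def inner_diff_right algebra_simps)
qed

text \<open>
  The gradient is uniformly continuous, so the remainder in Taylor's formula is at most \<open>B |h|\<close> for
  all small \<open>h\<close>, with the same threshold at every \<open>x\<close>. Squaring costs a cross term \<open>2 L B |h|\<^sup>2\<close>,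
  with \<open>L\<close> a bound for the gradient.
\<close>

lemma Cc_infty_quadratic_bound:
  fixes \<phi> :: "'a::euclidean_space \<Rightarrow> real"
  assumes \<phi>: "\<phi> \<in> Cc_infty \<Omega>" and e: "\<epsilon> > 0"
  obtains r where "r > 0"
    "\<And>x h. norm h < r \<Longrightarrow> (\<phi> x - \<phi> (x - h))\<^sup>2 \<le> (grad \<phi> x \<bullet> h)\<^sup>2 + \<epsilon> * (norm h)\<^sup>2"
proof -
  obtain K where K: "compact K" "\<And>x. x \<notin> K \<Longrightarrow> grad \<phi> x = 0"
    by (rule Cc_infty_support[OF \<phi>]) blast
  obtain L where L: "L \<ge> 0" "\<And>x. norm (grad \<phi> x) \<le> L"
    by (rule bounded_of_compact_support[OF continuous_grad[OF \<phi>] K]) blast+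
  \<comment> \<open>\<open>B \<le> 1\<close> turns the quadratic term \<open>B\<^sup>2\<close> of the square into a linear one.\<close>
  define B where "B = min 1 (\<epsilon> / (2 * L + 1))"
  have B: "B > 0" "B \<le> 1" "B * (2 * L + 1) \<le> \<epsilon>"
  proof -
    have pos: "2 * L + 1 > 0" using L(1) by linarith
    have "B * (2 * L + 1) \<le> \<epsilon> / (2 * L + 1) * (2 * L + 1)"
      using pos by (intro mult_right_mono) (auto simp: B_def)
    then show "B * (2 * L + 1) \<le> \<epsilon>" using pos by simp
    show "B > 0" "B \<le> 1" using pos e by (auto simp: B_def)
  qed
  obtain r where r: "r > 0" "\<And>x y. dist y x < r \<Longrightarrow> dist (grad \<phi> y) (grad \<phi> x) < B"
    using uniformly_continuous_of_compact_support[OF continuous_grad[OF \<phi>] K] B(1)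
    unfolding uniformly_continuous_on_def by auto
  show ?thesis
  proof (rule that[OF r(1)])
    fix x h :: 'a assume h: "norm h < r"
    have "\<bar>\<phi> (x - h) - \<phi> x - grad \<phi> x \<bullet> ((x - h) - x)\<bar> \<le> B * norm ((x - h) - x)"
    proof (rule Taylor_bound[OF Cc_infty_has_derivative[OF \<phi>]])
      fix y assume "norm (y - x) \<le> norm ((x - h) - x)"
      then show "norm (grad \<phi> y - grad \<phi> x) \<le> B"
        using r(2)[of y x] h by (simp add: dist_norm)
    qed
    then have "\<bar>(\<phi> x - \<phi> (x - h)) - grad \<phi> x \<bullet> h\<bar> \<le> B * norm h" by simp
    moreover define a where "a = \<phi> x - \<phi> (x - h)"
    moreover define b where "b = grad \<phi> x \<bullet> h"
    ultimately have ab: "\<bar>a - b\<bar> \<le> B * norm h" by simp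
    have b: "\<bar>b\<bar> \<le> L * norm h"
      unfolding b_def using Cauchy_Schwarz_ineq2[of "grad \<phi> x" h] L(2)[of x]
      by (meson mult_right_mono norm_ge_zero order_trans)
    have "a\<^sup>2 = b\<^sup>2 + (a - b) * (2 * b + (a - b))"
      by (simp add: power2_eq_square algebra_simps)
    also have "(a - b) * (2 * b + (a - b)) \<le> \<bar>a - b\<bar> * \<bar>2 * b + (a - b)\<bar>"
      by (subst abs_mult[symmetric]) (rule abs_ge_self)
    also have "\<dots> \<le> (B * norm h) * (2 * (L * norm h) + 1 * norm h)"
    proof (rule mult_mono[OF ab])
      have "B * norm h \<le> 1 * norm h" using B(2) by (intro mult_right_mono) auto
      then show "\<bar>2 * b + (a - b)\<bar> \<le> 2 * (L * norm h) + 1 * norm h" using ab b by linarith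
    qed (use B(1) in auto)
    also have "\<dots> = (B * (2 * L + 1)) * (norm h)\<^sup>2"
      by (simp add: power2_eq_square algebra_simps)
    also have "\<dots> \<le> \<epsilon> * (norm h)\<^sup>2" using B(3) by (intro mult_right_mono) auto
    finally show "(\<phi> x - \<phi> (x - h))\<^sup>2 \<le> (grad \<phi> x \<bullet> h)\<^sup>2 + \<epsilon> * (norm h)\<^sup>2"
      by (simp add: a_def b_def)
  qed
qed

lemma Lipschitz_of_gradient_bound:
  fixes F :: "'a::euclidean_space \<Rightarrow> real"
  assumes "\<And>x. (F has_derivative (\<lambda>h. G x \<bullet> h)) (at x)" "\<And>x. norm (G x) \<le> L"
  shows "\<bar>F z - F x\<bar> \<le> L * norm (z - x)"
  using Taylor_bound[of F G x z 0 L] assms by simp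

text \<open>
  By translation invariance the difference quotients of \<open>F\<close> in direction \<open>b\<close> have integral zero, and
  they converge to the directional derivative, dominated by the Lipschitz constant on a fixed ball.
\<close>

lemma integral_gradient_eq_0:
  fixes F :: "'a::euclidean_space \<Rightarrow> real"
  assumes der: "\<And>x. (F has_derivative (\<lambda>h. G x \<bullet> h)) (at x)"
    and cont: "continuous_on UNIV G" and K: "compact K" "\<And>x. x \<notin> K \<Longrightarrow> F x = 0" "\<And>x. x \<notin> K \<Longrightarrow> G x = 0"
  shows "(LINT x|lborel. G x \<bullet> b) = 0"
proof -
  obtain R where R: "K \<subseteq> cball 0 R"
    using compact_imp_bounded[OF K(1)] bounded_subset_ballD[of K 0] ball_subset_cball by blast
  have int_ball: "integrable lborel (\<lambda>x. c * indicator (cball (0::'a) r) x :: real)" for c r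
    using emeasure_bounded_finite[of "cball (0::'a) r"]
    by (intro integrable_mult_right integrable_real_indicator) auto
  obtain L where L: "L \<ge> 0" "\<And>x. norm (G x) \<le> L"
    by (rule bounded_of_compact_support[OF cont K(1,3)]) blast+
  have contF: "continuous_on UNIV F"
    using der by (auto intro!: continuous_at_imp_continuous_on has_derivative_continuous)
  have [measurable]: "F \<in> borel_measurable borel" "G \<in> borel_measurable borel"
    using contF cont by (auto intro: borel_measurable_continuous_onI)
  define t where "t n = inverse (real (Suc n))" for n
  have t: "t n > 0" "t n \<le> 1" for n by (auto simp: t_def field_simps)
  have t0: "t \<longlonglongrightarrow> 0" unfolding t_def by (rule LIMSEQ_inverse_real_of_nat)
  define s where "s n x = (F (t n *\<^sub>R b + x) - F x) / t n" for n x
  have intF: "integrable lborel F"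
  proof -
    obtain M where M: "\<And>x. norm (F x) \<le> M"
      by (rule bounded_of_compact_support[OF contF K(1,2)]) blast+
    show ?thesis
    proof (rule Bochner_Integration.integrable_bound[of _ "\<lambda>x. M * indicator (cball 0 R) x"])
      show "integrable lborel (\<lambda>x::'a. M * indicator (cball 0 R) x)" by (rule int_ball)
      show "AE x in lborel. norm (F x) \<le> norm (M * indicator (cball 0 R) x)"
      proof (rule AE_I2)
        fix x
        show "norm (F x) \<le> norm (M * indicator (cball 0 R) x)"
        proof (cases "x \<in> cball 0 R")
          case True
          then show ?thesis using M[of x] by simp
        next
          case False
          then have "x \<notin> K" using R by blast
          then show ?thesis using K(2) by simp
        qed
      qed
    qed simp
  qed
  have s0: "integral\<^sup>L lborel (s n) = 0" for n
  proof -
    have eq: "(LINT x|lborel. F (t n *\<^sub>R b + x)) = integral\<^sup>L lborel F"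
    proof -
      have "integral\<^sup>L lborel F = integral\<^sup>L (distr lborel borel ((+) (t n *\<^sub>R b))) F"
        by (simp add: lborel_distr_plus)
      also have "\<dots> = (LINT x|lborel. F (t n *\<^sub>R b + x))" by (rule integral_distr) auto
      finally show ?thesis by simp
    qed
    have "integrable (distr lborel borel ((+) (t n *\<^sub>R b))) F"
      using intF by (simp add: lborel_distr_plus)
    then have "integrable lborel (\<lambda>x. F (t n *\<^sub>R b + x))" by (subst (asm) integrable_distr_eq) auto
    then show ?thesis unfolding s_def using intF eq by simp
  qed
  have "(\<lambda>n. integral\<^sup>L lborel (s n)) \<longlonglongrightarrow> (LINT x|lborel. G x \<bullet> b)"
  proof (rule integral_dominated_convergence[where w="\<lambda>x. (L * norm b) * indicator (cball 0 (R + norm b)) x"])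
    show "integrable lborel (\<lambda>x::'a. (L * norm b) * indicator (cball 0 (R + norm b)) x)"
      by (rule int_ball)
    show "AE x in lborel. (\<lambda>n. s n x) \<longlonglongrightarrow> G x \<bullet> b"
    proof (rule AE_I2)
      fix x
      have "((\<lambda>u. F (u *\<^sub>R b + x)) has_derivative (\<lambda>u. G x \<bullet> (u *\<^sub>R b))) (at 0)"
        by (rule has_derivative_compose[of "\<lambda>u. u *\<^sub>R b + x" "\<lambda>u. u *\<^sub>R b" 0 UNIV F, simplified])
          (auto intro!: derivative_eq_intros der)
      moreover have "(\<lambda>u. G x \<bullet> (u *\<^sub>R b)) = (*) (G x \<bullet> b)" by (auto simp: fun_eq_iff)
      ultimately have "((\<lambda>u. F (u *\<^sub>R b + x)) has_field_derivative (G x \<bullet> b)) (at 0)"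
        by (simp only: has_field_derivative_def)
      then have "((\<lambda>u. (F (u *\<^sub>R b + x) - F x) / u) \<longlongrightarrow> G x \<bullet> b) (at 0)"
        by (simp add: has_field_derivative_iff)
      moreover have "filterlim t (at 0) sequentially"
        using t0 t(1)[THEN less_imp_neq] by (auto simp: filterlim_at)
      ultimately show "(\<lambda>n. s n x) \<longlonglongrightarrow> G x \<bullet> b"
        unfolding s_def by (rule filterlim_compose)
    qed
    show "AE x in lborel. norm (s n x) \<le> (L * norm b) * indicator (cball 0 (R + norm b)) x" for n
    proof (rule AE_I2)
      fix x
      show "norm (s n x) \<le> (L * norm b) * indicator (cball 0 (R + norm b)) x"
      proof (cases "x \<in> cball 0 (R + norm b)")
        case True
        have "\<bar>F (t n *\<^sub>R b + x) - F x\<bar> \<le> L * norm (t n *\<^sub>R b)"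
          using Lipschitz_of_gradient_bound[OF der L(2), of "t n *\<^sub>R b + x" x] by simp
        then show ?thesis using True t[of n]
          by (simp add: s_def abs_divide pos_divide_le_eq) (simp add: mult_ac)
      next
        case False
        then have far: "R + norm b < norm x" by simp
        have "norm x \<le> norm (t n *\<^sub>R b + x) + norm (t n *\<^sub>R b)"
          using norm_triangle_ineq4[of "t n *\<^sub>R b + x" "t n *\<^sub>R b"] by simp
        moreover have "norm (t n *\<^sub>R b) \<le> 1 * norm b"
          unfolding norm_scaleR using t[of n] by (intro mult_right_mono) auto
        ultimately have "norm (t n *\<^sub>R b + x) > R" "norm x > R"
          using far norm_ge_zero[of b] by linarith+
        then have "t n *\<^sub>R b + x \<notin> K" "x \<notin> K" using R by auto
        then show ?thesis using K(2) False by (simp add: s_def)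
      qed
    qed
  qed (auto simp: s_def[abs_def])
  then show ?thesis unfolding s0 by (simp add: LIMSEQ_const_iff)
qed

section \<open>Weak gradients and the local problem\<close>

lemma has_derivative_mult_gradient:
  fixes F H :: "'a::euclidean_space \<Rightarrow> real"
  assumes "(F has_derivative (\<lambda>h. v \<bullet> h)) (at x)" "(H has_derivative (\<lambda>h. w \<bullet> h)) (at x)"
  shows "((\<lambda>y. F y * H y) has_derivative (\<lambda>h. (F x *\<^sub>R w + H x *\<^sub>R v) \<bullet> h)) (at x)"
  using has_derivative_mult[OF assms] by (simp add: inner_add_left mult.commute)

lemma integrable_lebesgue_on_bounded:
  fixes g :: "'a::euclidean_space \<Rightarrow> 'b::euclidean_space"
  assumes "S \<in> lmeasurable" "g \<in> borel_measurable (lebesgue_on S)"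
    and "AE x in lebesgue_on S. norm (g x) \<le> M"
  shows "integrable (lebesgue_on S) g"
  using finite_measure.integrable_const_bound[OF finite_measure_lebesgue_on] assms by blast

lemma measurable_lebesgue_on_continuous:
  fixes g :: "'a::euclidean_space \<Rightarrow> 'b::euclidean_space"
  assumes "continuous_on UNIV g"
  shows "g \<in> borel_measurable (lebesgue_on S)"
proof -
  have "g \<in> borel_measurable lborel"
    using borel_measurable_continuous_onI[OF assms] by simp
  then show ?thesis
    by (intro measurable_restrict_space1 measurable_completion)
qed

lemma L2_bounded_continuous:
  fixes g :: "'a::euclidean_space \<Rightarrow> 'b::euclidean_space"
  assumes S: "S \<in> lmeasurable" and g: "continuous_on UNIV g" "\<And>x. norm (g x) \<le> M"
  shows "g \<in> L2 S"
proof -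
  have "integrable (lebesgue_on S) (\<lambda>x. (norm (g x))\<^sup>2)"
  proof (rule integrable_lebesgue_on_bounded[OF S, where M="M\<^sup>2"])
    show "(\<lambda>x. (norm (g x))\<^sup>2) \<in> borel_measurable (lebesgue_on S)"
      using g by (intro measurable_lebesgue_on_continuous continuous_intros)
    show "AE x in lebesgue_on S. norm ((norm (g x))\<^sup>2) \<le> M\<^sup>2"
      using g(2) by (auto intro!: power_mono)
  qed
  then show ?thesis
    using measurable_lebesgue_on_continuous[OF g(1)] by (simp add: L2_def)
qed

lemma integrable_L2_mult:
  fixes u v :: "'a::euclidean_space \<Rightarrow> 'b::euclidean_space"
  assumes "u \<in> L2 S" "v \<in> L2 S"
    and \<sigma>: "\<sigma> \<in> borel_measurable (lebesgue_on S)" "AE x in lebesgue_on S. \<bar>\<sigma> x\<bar> \<le> M"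
  shows "integrable (lebesgue_on S) (\<lambda>x. \<sigma> x * (u x \<bullet> v x))"
proof (rule Bochner_Integration.integrable_bound)
  show "integrable (lebesgue_on S) (\<lambda>x. M * ((norm (u x))\<^sup>2 + (norm (v x))\<^sup>2))"
    using assms by (auto simp: L2_def)
  have [measurable]: "u \<in> borel_measurable (lebesgue_on S)" "v \<in> borel_measurable (lebesgue_on S)"
    using assms by (auto simp: L2_def)
  show "(\<lambda>x. \<sigma> x * (u x \<bullet> v x)) \<in> borel_measurable (lebesgue_on S)"
    using \<sigma>(1) by measurable
  show "AE x in lebesgue_on S. norm (\<sigma> x * (u x \<bullet> v x)) \<le> norm (M * ((norm (u x))\<^sup>2 + (norm (v x))\<^sup>2))"
    using \<sigma>(2)
  proof eventually_elim
    fix x assume M: "\<bar>\<sigma> x\<bar> \<le> M"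
    have "\<bar>u x \<bullet> v x\<bar> \<le> norm (u x) * norm (v x)" by (rule Cauchy_Schwarz_ineq2)
    also have "\<dots> \<le> (norm (u x))\<^sup>2 + (norm (v x))\<^sup>2"
      using sum_squares_bound[of "norm (u x)" "norm (v x)"]
        mult_nonneg_nonneg[OF norm_ge_zero[of "u x"] norm_ge_zero[of "v x"]] by linarith
    finally have "\<bar>\<sigma> x\<bar> * \<bar>u x \<bullet> v x\<bar> \<le> M * ((norm (u x))\<^sup>2 + (norm (v x))\<^sup>2)"
      using M by (intro mult_mono) auto
    moreover have "M \<ge> 0" using M abs_ge_zero[of "\<sigma> x"] by linarith
    ultimately show "norm (\<sigma> x * (u x \<bullet> v x)) \<le> norm (M * ((norm (u x))\<^sup>2 + (norm (v x))\<^sup>2))"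
      by (simp add: abs_mult)
  qed
qed

lemma Cc_infty_bounded:
  assumes "\<phi> \<in> Cc_infty \<Omega>"
  obtains L where "L \<ge> 0" "\<And>x. \<bar>\<phi> x\<bar> \<le> L" "\<And>x. norm (grad \<phi> x) \<le> L"
proof -
  obtain K where K: "compact K" "\<And>x. x \<notin> K \<Longrightarrow> \<phi> x = 0" "\<And>x. x \<notin> K \<Longrightarrow> grad \<phi> x = 0"
    by (rule Cc_infty_support[OF assms]) blast
  obtain L1 where L1: "L1 \<ge> 0" "\<And>x. norm (\<phi> x) \<le> L1"
    by (rule bounded_of_compact_support[OF continuous_Cc_infty[OF assms] K(1,2)]) blast+
  obtain L2 where L2: "L2 \<ge> 0" "\<And>x. norm (grad \<phi> x) \<le> L2"
    by (rule bounded_of_compact_support[OF continuous_grad[OF assms] K(1,3)]) blast+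
  show ?thesis
    by (rule that[of "L1 + L2"]) (use L1 L2 in \<open>auto intro: order_trans add_increasing add_increasing2\<close>)
qed

lemma Cc_infty_L2:
  fixes \<phi> :: "'a::euclidean_space \<Rightarrow> real"
  assumes "\<phi> \<in> Cc_infty \<Omega>" "S \<in> lmeasurable"
  shows "\<phi> \<in> L2 S" "grad \<phi> \<in> L2 S" "(\<lambda>x. grad \<phi> x \<bullet> b) \<in> L2 S"
proof -
  obtain L where L: "L \<ge> 0" "\<And>x. \<bar>\<phi> x\<bar> \<le> L" "\<And>x. norm (grad \<phi> x) \<le> L"
    using Cc_infty_bounded[OF assms(1)] by blast
  have "\<bar>grad \<phi> x \<bullet> b\<bar> \<le> L * norm b" for x
    using Cauchy_Schwarz_ineq2[of "grad \<phi> x" b] L(3)[of x] by (simp add: mult_right_mono order_trans)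
  then show "\<phi> \<in> L2 S" "grad \<phi> \<in> L2 S" "(\<lambda>x. grad \<phi> x \<bullet> b) \<in> L2 S"
    using L assms continuous_Cc_infty[OF assms(1)] continuous_grad[OF assms(1)]
    by (auto intro!: L2_bounded_continuous continuous_intros)
qed

lemma integral_lebesgue_on_support:
  fixes g :: "'a::euclidean_space \<Rightarrow> real"
  assumes "S \<in> sets lebesgue" "\<And>x. x \<notin> S \<Longrightarrow> g x = 0"
  shows "integral\<^sup>L (lebesgue_on S) g = integral\<^sup>L lebesgue g"
  using assms by (subst integral_restrict_space) (auto intro!: Bochner_Integration.integral_cong split: split_indicator)

text \<open>
  Integration by parts: the gradient of the product of two test functions integrates to zero.
\<close>

lemma has_weak_gradient_grad:
  fixes \<phi> :: "'a::euclidean_space \<Rightarrow> real"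
  assumes \<Omega>: "open \<Omega>" "bounded \<Omega>" and \<phi>: "\<phi> \<in> Cc_infty \<Omega>"
  shows "has_weak_gradient \<Omega> \<phi> (grad \<phi>)"
  unfolding has_weak_gradient_def
proof (intro conjI ballI)
  have lm: "\<Omega> \<in> lmeasurable" using \<Omega> by (rule lmeasurable_open[rotated])
  show "grad \<phi> \<in> L2 \<Omega>" using Cc_infty_L2[OF \<phi> lm] by simp
  fix \<psi> b assume \<psi>: "\<psi> \<in> Cc_infty \<Omega>"
  obtain K where K: "compact K" "K \<subseteq> \<Omega>" "\<And>x. x \<notin> K \<Longrightarrow> \<phi> x = 0" "\<And>x. x \<notin> K \<Longrightarrow> grad \<phi> x = 0"
    by (rule Cc_infty_support[OF \<phi>]) blast
  have c: "continuous_on UNIV \<phi>" "continuous_on UNIV (grad \<phi>)" "continuous_on UNIV \<psi>" "continuous_on UNIV (grad \<psi>)"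
    using \<phi> \<psi> continuous_Cc_infty continuous_grad by blast+
  define G where "G x = \<phi> x *\<^sub>R grad \<psi> x + \<psi> x *\<^sub>R grad \<phi> x" for x
  have "continuous_on UNIV G" unfolding G_def[abs_def] using c by (intro continuous_intros)
  have "(LINT x|lborel. G x \<bullet> b) = 0"
  proof (rule integral_gradient_eq_0)
    show "((\<lambda>x. \<phi> x * \<psi> x) has_derivative (\<lambda>h. G x \<bullet> h)) (at x)" for x
      unfolding G_def using \<phi> \<psi> by (intro has_derivative_mult_gradient Cc_infty_has_derivative)
    show "continuous_on UNIV G" by fact
    show "compact K" by fact
  qed (simp_all add: K G_def)
  moreover have "(\<lambda>x. G x \<bullet> b) \<in> borel_measurable lborel"
    using \<open>continuous_on UNIV G\<close> by (auto intro!: borel_measurable_continuous_onI continuous_intros)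
  ultimately have "(LINT x|lebesgue. G x \<bullet> b) = 0" by (simp add: integral_completion)
  moreover have "(LINT x|lebesgue_on \<Omega>. G x \<bullet> b) = (LINT x|lebesgue. G x \<bullet> b)"
      proof (rule integral_lebesgue_on_support)
    fix x assume "x \<notin> \<Omega>"
    then have "x \<notin> K" using K(2) by blast
    then show "G x \<bullet> b = 0" by (simp add: G_def K)
  qed (use lm in auto)
  ultimately have "(LINT x|lebesgue_on \<Omega>. G x \<bullet> b) = 0" by simp
  moreover have "(LINT x|lebesgue_on \<Omega>. G x \<bullet> b)
     = (LINT x|lebesgue_on \<Omega>. \<phi> x * (grad \<psi> x \<bullet> b)) + (LINT x|lebesgue_on \<Omega>. (grad \<phi> x \<bullet> b) * \<psi> x)"
  proof -
    have "integrable (lebesgue_on \<Omega>) (\<lambda>x. \<phi> x * (grad \<psi> x \<bullet> b))"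
      using integrable_L2_mult[OF Cc_infty_L2(1)[OF \<phi> lm] Cc_infty_L2(3)[OF \<psi> lm, of b], of "\<lambda>_. 1" 1] by simp
    moreover have "integrable (lebesgue_on \<Omega>) (\<lambda>x. (grad \<phi> x \<bullet> b) * \<psi> x)"
      using integrable_L2_mult[OF Cc_infty_L2(3)[OF \<phi> lm, of b] Cc_infty_L2(1)[OF \<psi> lm], of "\<lambda>_. 1" 1] by simp
    ultimately show ?thesis
      by (subst Bochner_Integration.integral_add[symmetric])
        (auto simp: G_def inner_add_left mult.commute intro!: Bochner_Integration.integral_cong)
  qed
  ultimately show "(LINT x|lebesgue_on \<Omega>. \<phi> x * frechet_derivative \<psi> (at x) b)
      = - (LINT x|lebesgue_on \<Omega>. (grad \<phi> x \<bullet> b) * \<psi> x)"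
    by (simp add: frechet_derivative_Cc_infty[OF \<psi>])
qed

lemma has_weak_gradient_add_test:
  fixes u :: "'a::euclidean_space \<Rightarrow> real"
  assumes \<Omega>: "open \<Omega>" "bounded \<Omega>" and u: "u \<in> L2 \<Omega>" and \<phi>: "\<phi> \<in> Cc_infty \<Omega>"
    and G: "has_weak_gradient \<Omega> (\<lambda>x. u x - \<phi> x) G"
  shows "has_weak_gradient \<Omega> u (\<lambda>x. G x + grad \<phi> x)"
  unfolding has_weak_gradient_def
proof (intro conjI ballI)
  have lm: "\<Omega> \<in> lmeasurable" using \<Omega> by (rule lmeasurable_open[rotated])
  have GL2: "G \<in> L2 \<Omega>" using G by (simp add: has_weak_gradient_def)
  note \<phi>L2 = Cc_infty_L2[OF \<phi> lm]
  show "(\<lambda>x. G x + grad \<phi> x) \<in> L2 \<Omega>"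
  proof -
    have m: "G \<in> borel_measurable (lebesgue_on \<Omega>)" "grad \<phi> \<in> borel_measurable (lebesgue_on \<Omega>)"
      using GL2 \<phi>L2 by (auto simp: L2_def)
    have "integrable (lebesgue_on \<Omega>) (\<lambda>x. (norm (G x))\<^sup>2 + 2 * (1 * (G x \<bullet> grad \<phi> x)) + (norm (grad \<phi> x))\<^sup>2)"
      using GL2 \<phi>L2 integrable_L2_mult[OF GL2 \<phi>L2(2), of "\<lambda>_. 1" 1] by (auto simp: L2_def)
    then show ?thesis
      using m by (simp add: L2_def power2_norm_eq_inner inner_simps inner_commute algebra_simps)
  qed
  fix \<psi> b assume \<psi>: "\<psi> \<in> Cc_infty \<Omega>" and b: "b \<in> (Basis :: 'a set)"
  note \<psi>L2 = Cc_infty_L2[OF \<psi> lm]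
  have int: "integrable (lebesgue_on \<Omega>) (\<lambda>x. u x * (grad \<psi> x \<bullet> b))"
      "integrable (lebesgue_on \<Omega>) (\<lambda>x. \<phi> x * (grad \<psi> x \<bullet> b))"
      "integrable (lebesgue_on \<Omega>) (\<lambda>x. (grad \<phi> x \<bullet> b) * \<psi> x)"
    using integrable_L2_mult[OF u \<psi>L2(3)[of b], of "\<lambda>_. 1" 1]
      integrable_L2_mult[OF \<phi>L2(1) \<psi>L2(3)[of b], of "\<lambda>_. 1" 1]
      integrable_L2_mult[OF \<phi>L2(3)[of b] \<psi>L2(1), of "\<lambda>_. 1" 1] by simp_all
  have "(\<lambda>x. \<psi> x *\<^sub>R b) \<in> L2 \<Omega>"
    using \<psi>L2(1) b by (auto simp: L2_def)
  then have intG: "integrable (lebesgue_on \<Omega>) (\<lambda>x. (G x \<bullet> b) * \<psi> x)"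
    using integrable_L2_mult[OF GL2, of "\<lambda>x. \<psi> x *\<^sub>R b" "\<lambda>_. 1" 1] by (simp add: mult.commute)
  have 1: "(LINT x|lebesgue_on \<Omega>. (u x - \<phi> x) * (grad \<psi> x \<bullet> b)) = - (LINT x|lebesgue_on \<Omega>. (G x \<bullet> b) * \<psi> x)"
  proof -
    have "(LINT x|lebesgue_on \<Omega>. (u x - \<phi> x) * frechet_derivative \<psi> (at x) b) = - (LINT x|lebesgue_on \<Omega>. (G x \<bullet> b) * \<psi> x)"
      using G \<psi> b unfolding has_weak_gradient_def by blast
    then show ?thesis by (simp add: frechet_derivative_Cc_infty[OF \<psi>])
  qed
  have 2: "(LINT x|lebesgue_on \<Omega>. \<phi> x * (grad \<psi> x \<bullet> b)) = - (LINT x|lebesgue_on \<Omega>. (grad \<phi> x \<bullet> b) * \<psi> x)"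
  proof -
    have "(LINT x|lebesgue_on \<Omega>. \<phi> x * frechet_derivative \<psi> (at x) b) = - (LINT x|lebesgue_on \<Omega>. (grad \<phi> x \<bullet> b) * \<psi> x)"
      using has_weak_gradient_grad[OF \<Omega> \<phi>] \<psi> b unfolding has_weak_gradient_def by blast
    then show ?thesis by (simp add: frechet_derivative_Cc_infty[OF \<psi>])
  qed
  have "(LINT x|lebesgue_on \<Omega>. u x * (grad \<psi> x \<bullet> b)) = - (LINT x|lebesgue_on \<Omega>. ((G x + grad \<phi> x) \<bullet> b) * \<psi> x)"
    using 1 2 int intG by (simp add: left_diff_distrib distrib_right inner_add_left)
  then show "(LINT x|lebesgue_on \<Omega>. u x * frechet_derivative \<psi> (at x) b)
      = - (LINT x|lebesgue_on \<Omega>. ((G x + grad \<phi> x) \<bullet> b) * \<psi> x)"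
    by (simp add: frechet_derivative_Cc_infty[OF \<psi>])
qed

lemma zero_weak_gradient: "has_weak_gradient \<Omega> (\<lambda>x. 0) (\<lambda>x. 0)"
  by (simp add: has_weak_gradient_def L2_def)

lemma Cc_infty_in_W12_0:
  fixes \<phi> :: "'a::euclidean_space \<Rightarrow> real"
  assumes \<Omega>: "open \<Omega>" "bounded \<Omega>" and \<phi>: "\<phi> \<in> Cc_infty \<Omega>"
  shows "\<phi> \<in> W12_0 \<Omega>"
proof -
  have "\<phi> \<in> W12 \<Omega>"
    using has_weak_gradient_grad[OF assms] Cc_infty_L2(1)[OF \<phi> lmeasurable_open[OF \<Omega>(2,1)]]
    unfolding W12_def by blast
  moreover have "\<exists>\<phi>'\<in>Cc_infty \<Omega>. \<exists>G. has_weak_gradient \<Omega> (\<lambda>x. \<phi> x - \<phi>' x) G \<and>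
     sqrt ((LINT x|lebesgue_on \<Omega>. (\<phi> x - \<phi>' x)\<^sup>2) + (LINT x|lebesgue_on \<Omega>. (norm (G x))\<^sup>2)) < \<epsilon>" if "\<epsilon> > 0" for \<epsilon>
    using that zero_weak_gradient by (intro bexI[OF _ \<phi>] exI[of _ "\<lambda>x. 0"]) simp
  ultimately show ?thesis unfolding W12_0_def by blast
qed

text \<open>
  Completing the square turns the defect into \<open>\<integral> \<sigma> |\<nabla>u - \<nabla>\<phi>|\<^sup>2\<close>, which is small for
  suitable \<open>\<phi>\<close> by the definition of \<open>W12_0\<close>. That definition supplies some weak gradient \<open>G\<close> of
  \<open>u - \<phi>\<close>. Choosing \<open>G + \<nabla>\<phi>\<close> as the weak gradient of \<open>u\<close> in the state equation makes the
  square refer to this very \<open>G\<close>, whose norm is under control.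
\<close>

lemma local_compliance_approx:
  fixes u :: "'a::euclidean_space \<Rightarrow> real"
  assumes \<Omega>: "open \<Omega>" "bounded \<Omega>" and u: "loc_solution \<Omega> f \<sigma> u"
    and \<sigma>: "\<sigma> \<in> borel_measurable (lebesgue_on \<Omega>)" "AE x in lebesgue_on \<Omega>. \<bar>\<sigma> x\<bar> \<le> M"
    and \<eta>: "\<eta> > 0"
  obtains \<phi> where "\<phi> \<in> Cc_infty \<Omega>"
    "load \<Omega> f u - \<eta> \<le> 2 * load \<Omega> f \<phi> - (LINT x|lebesgue_on \<Omega>. \<sigma> x * (norm (grad \<phi> x))\<^sup>2)"
proof -
  have lm: "\<Omega> \<in> lmeasurable" using \<Omega> by (rule lmeasurable_open[rotated])
  have uW: "u \<in> W12_0 \<Omega>" and uL2: "u \<in> L2 \<Omega>"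
    and sol: "\<And>v G H. v \<in> W12_0 \<Omega> \<Longrightarrow> has_weak_gradient \<Omega> u G \<Longrightarrow> has_weak_gradient \<Omega> v H \<Longrightarrow>
        (LINT x|lebesgue_on \<Omega>. \<sigma> x * (G x \<bullet> H x)) = load \<Omega> f v"
    using u by (auto simp: loc_solution_def W12_0_def W12_def)
  define \<epsilon> where "\<epsilon> = sqrt (\<eta> / (\<bar>M\<bar> + 1))"
  have \<epsilon>: "\<epsilon> > 0" "(\<bar>M\<bar> + 1) * \<epsilon>\<^sup>2 = \<eta>" using \<eta> by (auto simp: \<epsilon>_def)
  obtain \<phi> G where \<phi>: "\<phi> \<in> Cc_infty \<Omega>" and G: "has_weak_gradient \<Omega> (\<lambda>x. u x - \<phi> x) G"
    and small: "sqrt ((LINT x|lebesgue_on \<Omega>. (u x - \<phi> x)\<^sup>2) + (LINT x|lebesgue_on \<Omega>. (norm (G x))\<^sup>2)) < \<epsilon>"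
    using uW \<epsilon>(1) unfolding W12_0_def by blast
  have "sqrt (LINT x|lebesgue_on \<Omega>. (norm (G x))\<^sup>2) \<le>
      sqrt ((LINT x|lebesgue_on \<Omega>. (u x - \<phi> x)\<^sup>2) + (LINT x|lebesgue_on \<Omega>. (norm (G x))\<^sup>2))"
    by simp
  also note small
  finally have "sqrt (LINT x|lebesgue_on \<Omega>. (norm (G x))\<^sup>2) < \<epsilon>" .
  then have Gsmall: "(LINT x|lebesgue_on \<Omega>. (norm (G x))\<^sup>2) \<le> \<epsilon>\<^sup>2"
    using \<epsilon>(1) by (simp add: sqrt_le_D less_imp_le)
  define V where "V x = G x + grad \<phi> x" for x
  have V: "has_weak_gradient \<Omega> u V"
    unfolding V_def[abs_def] by (rule has_weak_gradient_add_test[OF \<Omega> uL2 \<phi> G])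
  have L2s: "G \<in> L2 \<Omega>" "V \<in> L2 \<Omega>" "grad \<phi> \<in> L2 \<Omega>"
    using G V Cc_infty_L2(2)[OF \<phi> lm] by (auto simp: has_weak_gradient_def)
  note int = integrable_L2_mult[OF L2s(2,2) \<sigma>] integrable_L2_mult[OF L2s(2,3) \<sigma>]
    integrable_L2_mult[OF L2s(3,3) \<sigma>] integrable_L2_mult[OF L2s(1,1) \<sigma>]
  have eq1: "(LINT x|lebesgue_on \<Omega>. \<sigma> x * (V x \<bullet> V x)) = load \<Omega> f u"
    by (rule sol[OF uW V V])
  have eq2: "(LINT x|lebesgue_on \<Omega>. \<sigma> x * (V x \<bullet> grad \<phi> x)) = load \<Omega> f \<phi>"
    by (rule sol[OF Cc_infty_in_W12_0[OF \<Omega> \<phi>] V has_weak_gradient_grad[OF \<Omega> \<phi>]])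
  have "(LINT x|lebesgue_on \<Omega>. \<sigma> x * (G x \<bullet> G x))
     = (LINT x|lebesgue_on \<Omega>. \<sigma> x * (V x \<bullet> V x) - 2 * (\<sigma> x * (V x \<bullet> grad \<phi> x)) + \<sigma> x * (grad \<phi> x \<bullet> grad \<phi> x))"
    by (simp add: V_def inner_simps inner_commute algebra_simps)
  also have "\<dots> = load \<Omega> f u - 2 * load \<Omega> f \<phi> + (LINT x|lebesgue_on \<Omega>. \<sigma> x * (grad \<phi> x \<bullet> grad \<phi> x))"
    using int eq1 eq2 by simp
  finally have expand: "(LINT x|lebesgue_on \<Omega>. \<sigma> x * (G x \<bullet> G x))
      = load \<Omega> f u - 2 * load \<Omega> f \<phi> + (LINT x|lebesgue_on \<Omega>. \<sigma> x * (grad \<phi> x \<bullet> grad \<phi> x))" .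
  have "(LINT x|lebesgue_on \<Omega>. \<sigma> x * (G x \<bullet> G x)) \<le> (LINT x|lebesgue_on \<Omega>. (\<bar>M\<bar> + 1) * (norm (G x))\<^sup>2)"
  proof (rule integral_mono_AE)
    show "integrable (lebesgue_on \<Omega>) (\<lambda>x. (\<bar>M\<bar> + 1) * (norm (G x))\<^sup>2)"
      using L2s(1) by (auto simp: L2_def)
    show "AE x in lebesgue_on \<Omega>. \<sigma> x * (G x \<bullet> G x) \<le> (\<bar>M\<bar> + 1) * (norm (G x))\<^sup>2"
      using \<sigma>(2) by eventually_elim (auto simp: power2_norm_eq_inner intro!: mult_right_mono)
  qed (rule int)
  also have "\<dots> = (\<bar>M\<bar> + 1) * (LINT x|lebesgue_on \<Omega>. (norm (G x))\<^sup>2)" by simp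
  also have "\<dots> \<le> (\<bar>M\<bar> + 1) * \<epsilon>\<^sup>2" using Gsmall by (intro mult_left_mono) auto
  finally show ?thesis
    using that[OF \<phi>] expand \<epsilon>(2) by (simp add: power2_norm_eq_inner)
qed

section \<open>The non-local energy of a test function\<close>

lemma measurable_nl_integrand:
  fixes S :: "'a::euclidean_space set"
  assumes k: "(\<lambda>x::'a. k (norm x)) \<in> borel_measurable lebesgue"
    and [measurable]: "\<gamma> \<in> borel_measurable (lebesgue_on S)" "u \<in> borel_measurable (lebesgue_on S)"
  shows "nl_integrand k (\<lambda>x x'. \<gamma> x * \<gamma> x') u u \<in> borel_measurable (lebesgue_on (S \<times> S))"
proof -
  have [measurable]: "fst \<in> lebesgue_on (S \<times> S) \<rightarrow>\<^sub>M lebesgue_on S" "snd \<in> lebesgue_on (S \<times> S) \<rightarrow>\<^sub>M lebesgue_on S"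
    by (rule measurable_restrict_space3[OF measurable_lebesgue_fst], auto)
       (rule measurable_restrict_space3[OF measurable_lebesgue_snd], auto)
  have [measurable]: "(\<lambda>z. k (norm (fst z - snd z))) \<in> borel_measurable (lebesgue_on (S \<times> S))"
    using measurable_compose[OF measurable_lebesgue_diff k] by (rule measurable_restrict_space1)
  have [measurable]: "(\<lambda>z. norm (fst z - snd z)) \<in> borel_measurable (lebesgue_on (S \<times> S))"
    by (intro measurable_lebesgue_on_continuous continuous_intros)
  show ?thesis
    unfolding nl_integrand_def split_beta by measurable
qed

text \<open>
  The heart of the proof. The weight \<open>\<gamma>(x) \<gamma>(y)\<close> is split by \<open>2 s t \<le> s\<^sup>2 + t\<^sup>2\<close>, and in each of the
  two terms the difference quotient is bounded by the linearisation at the point that carries the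
  weight. Both terms have the same integral: integrating the increment first gives
  \<open>|w|\<^sup>2 + n \<epsilon>\<close>, which leaves a single integral that is linear in \<open>\<gamma>\<^sup>2\<close>.
\<close>

lemma nn_integral_nl_integrand_le:
  fixes S :: "'a::euclidean_space set" and w :: "'a \<Rightarrow> 'a" and \<epsilon> :: real
  assumes S: "open S"
    and k: "integrable lebesgue (\<lambda>x::'a. k (norm x))" "(LINT x::'a|lebesgue. k (norm x)) = DIM('a)"
      "\<And>r. r \<ge> 0 \<Longrightarrow> k r \<ge> 0"
    and quad: "\<And>x h. k (norm h) \<noteq> 0 \<Longrightarrow> (\<phi> x - \<phi> (x - h))\<^sup>2 \<le> (w x \<bullet> h)\<^sup>2 + \<epsilon> * (norm h)\<^sup>2"
    and e: "\<epsilon> \<ge> 0" and w: "continuous_on UNIV w"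
    and \<gamma>: "\<gamma> \<in> borel_measurable (lebesgue_on S)" "\<And>x. \<gamma> x \<ge> 0"
  shows "(\<integral>\<^sup>+z. ennreal (nl_integrand k (\<lambda>x x'. \<gamma> x * \<gamma> x') \<phi> \<phi> z) \<partial>lebesgue_on (S \<times> S))
      \<le> (\<integral>\<^sup>+x. ennreal ((\<gamma> x)\<^sup>2 * ((norm (w x))\<^sup>2 + DIM('a) * \<epsilon>)) \<partial>lebesgue_on S)"
proof -
  have SS: "S \<times> S \<in> sets lebesgue" "S \<in> sets lebesgue" using S open_Times[OF S S] by auto
  \<comment> \<open>Kernel and weight are only Lebesgue measurable; Fubini's theorem is applied to Borel versions.\<close>
  define a where "a h = ennreal (k (norm h))" for h :: 'a
  define c where "c x = ennreal ((\<gamma> x)\<^sup>2) * indicator S x" for x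
  have "a \<in> borel_measurable lebesgue" using k(1) by (auto simp: a_def[abs_def])
  then obtain a' where a': "a' \<in> borel_measurable lborel" "AE h in lborel. a h = a' h"
    using completion_ex_borel_measurable by blast
  have "(\<lambda>x. (if x \<in> S then \<gamma> x else 0)) \<in> borel_measurable lebesgue"
    using \<gamma>(1) SS by (simp add: borel_measurable_if)
  then have "(\<lambda>x. ennreal ((if x \<in> S then \<gamma> x else 0)\<^sup>2)) \<in> borel_measurable lebesgue"
    by measurable
  also have "(\<lambda>x. ennreal ((if x \<in> S then \<gamma> x else 0)\<^sup>2)) = c"
    by (auto simp: c_def fun_eq_iff split: split_indicator)
  finally obtain c' where c': "c' \<in> borel_measurable lborel" "AE h in lborel. c h = c' h"
    using completion_ex_borel_measurable by blast
  have [measurable]: "a' \<in> borel_measurable borel" "c' \<in> borel_measurable borel"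
    using a' c' by auto
  have [measurable]: "w \<in> borel_measurable borel" by (rule borel_measurable_continuous_onI[OF w])
  define Q where "Q x h = (w x \<bullet> h / norm h)\<^sup>2 + \<epsilon>" for x h
  have Q0: "Q x h \<ge> 0" for x h using e by (simp add: Q_def)
  define F where "F z = ennreal (1/2) * (c' (fst z) * (a' (snd z) * ennreal (Q (fst z) (snd z))))" for z
  have F[measurable]: "F \<in> borel_measurable borel"
    unfolding F_def[abs_def] Q_def borel_prod[symmetric] by measurable
  have c'_fst: "AE z::'a \<times> 'a in lebesgue. c (fst z) = c' (fst z)"
    by (rule AE_lebesgue_pullback[OF AE_fst_notin AE_completion[OF c'(2)]])
  have c'_snd: "AE z::'a \<times> 'a in lebesgue. c (snd z) = c' (snd z)"
    by (rule AE_lebesgue_pullback[OF AE_snd_notin AE_completion[OF c'(2)]])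
  have a'_diff: "AE z in lebesgue. a (fst z - snd z) = a' (fst z - snd z)"
    by (rule AE_lebesgue_pullback[OF AE_diff_notin AE_completion[OF a'(2)]])
  have point: "nl_integrand k (\<lambda>x x'. \<gamma> x * \<gamma> x') \<phi> \<phi> (x, y)
      \<le> 1/2 * ((\<gamma> x)\<^sup>2 * (k (norm (x - y)) * Q x (x - y))) + 1/2 * ((\<gamma> y)\<^sup>2 * (k (norm (x - y)) * Q y (x - y)))" for x y
  proof (cases "x = y \<or> k (norm (x - y)) = 0")
    case True
    then show ?thesis using k(3)[of "norm (x - y)"] Q0
      by (auto simp: nl_integrand_def intro!: add_nonneg_nonneg mult_nonneg_nonneg)
  next
    case False
    define r where "r = norm (x - y)"
    have r: "r > 0" "k r \<ge> 0" using False k(3) by (auto simp: r_def)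
    define D where "D = ((\<phi> x - \<phi> y) / r)\<^sup>2"
    have "(\<phi> x - \<phi> (x - (x - y)))\<^sup>2 \<le> (w x \<bullet> (x - y))\<^sup>2 + \<epsilon> * r\<^sup>2"
      using quad[of "x - y" x] False by (simp add: r_def)
    then have Dx: "D \<le> Q x (x - y)"
      using r(1) by (simp add: D_def Q_def power_divide divide_simps flip: r_def)
    have "(\<phi> y - \<phi> (y - (y - x)))\<^sup>2 \<le> (w y \<bullet> (y - x))\<^sup>2 + \<epsilon> * r\<^sup>2"
      using quad[of "y - x" y] False by (simp add: r_def norm_minus_commute)
    moreover have "(w y \<bullet> (y - x))\<^sup>2 = (w y \<bullet> (x - y))\<^sup>2"
      by (simp add: inner_diff_right power2_commute)
    ultimately have Dy: "D \<le> Q y (x - y)"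
      using r(1) by (simp add: D_def Q_def power_divide divide_simps power2_commute[of "\<phi> y"] flip: r_def)
    have "\<gamma> x * \<gamma> y \<le> 1/2 * (\<gamma> x)\<^sup>2 + 1/2 * (\<gamma> y)\<^sup>2"
      using sum_squares_bound[of "\<gamma> x" "\<gamma> y"] by simp
    then have "\<gamma> x * \<gamma> y * (k r * D) \<le> (1/2 * (\<gamma> x)\<^sup>2 + 1/2 * (\<gamma> y)\<^sup>2) * (k r * D)"
      using r by (intro mult_right_mono) (auto simp: D_def)
    also have "\<dots> = 1/2 * ((\<gamma> x)\<^sup>2 * (k r * D)) + 1/2 * ((\<gamma> y)\<^sup>2 * (k r * D))"
      by (simp add: algebra_simps)
    also have "\<dots> \<le> 1/2 * ((\<gamma> x)\<^sup>2 * (k r * Q x (x - y))) + 1/2 * ((\<gamma> y)\<^sup>2 * (k r * Q y (x - y)))"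
      using Dx Dy r by (intro add_mono mult_left_mono) auto
    finally show ?thesis
      by (simp add: nl_integrand_def D_def power2_eq_square mult_ac flip: r_def)
  qed
  have AE_le: "AE z in lebesgue. ennreal (nl_integrand k (\<lambda>x x'. \<gamma> x * \<gamma> x') \<phi> \<phi> z) * indicator (S \<times> S) z
      \<le> F (fst z, fst z - snd z) + F (snd z, fst z - snd z)"
    using c'_fst c'_snd a'_diff
  proof eventually_elim
    fix z assume z: "c (fst z) = c' (fst z)" "c (snd z) = c' (snd z)" "a (fst z - snd z) = a' (fst z - snd z)"
    show "ennreal (nl_integrand k (\<lambda>x x'. \<gamma> x * \<gamma> x') \<phi> \<phi> z) * indicator (S \<times> S) z
      \<le> F (fst z, fst z - snd z) + F (snd z, fst z - snd z)"
    proof (cases "z \<in> S \<times> S")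
      case True
      then obtain x y where xy: "z = (x, y)" "x \<in> S" "y \<in> S" by auto
      have pos: "(\<gamma> x)\<^sup>2 * (k (norm (x - y)) * Q x (x - y)) \<ge> 0" "(\<gamma> y)\<^sup>2 * (k (norm (x - y)) * Q y (x - y)) \<ge> 0"
        using k(3)[of "norm (x - y)"] Q0 by simp_all
      have prod: "ennreal H * (ennreal A * (ennreal B * ennreal C)) = ennreal (H * (A * (B * C)))"
        if "H \<ge> 0" "A \<ge> 0" "B \<ge> 0" "C \<ge> 0" for H A B C
        using that by (simp add: ennreal_mult)
      have Fx: "F (x, x - y) = ennreal (1/2 * ((\<gamma> x)\<^sup>2 * (k (norm (x - y)) * Q x (x - y))))"
      proof -
        have "c' x = ennreal ((\<gamma> x)\<^sup>2)" "a' (x - y) = ennreal (k (norm (x - y)))"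
          using z xy by (simp_all add: c_def a_def)
        then show ?thesis
          unfolding F_def fst_conv snd_conv by (simp only:) (rule prod; use k(3) Q0 in simp)
      qed
      have Fy: "F (y, x - y) = ennreal (1/2 * ((\<gamma> y)\<^sup>2 * (k (norm (x - y)) * Q y (x - y))))"
      proof -
        have "c' y = ennreal ((\<gamma> y)\<^sup>2)" "a' (x - y) = ennreal (k (norm (x - y)))"
          using z xy by (simp_all add: c_def a_def)
        then show ?thesis
          unfolding F_def fst_conv snd_conv by (simp only:) (rule prod; use k(3) Q0 in simp)
      qed
      show ?thesis
        using point[of x y] pos by (simp add: xy Fx Fy ennreal_leI flip: ennreal_plus)
    next
      case False then show ?thesis by simp
    qed
  qed
  have inner: "(\<integral>\<^sup>+h. F (x, h) \<partial>lborel) = ennreal (1/2) * (c' x * ennreal ((norm (w x))\<^sup>2 + DIM('a) * \<epsilon>))" for x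
  proof -
    note mom = radial_second_moments[OF k(1), of "w x"]
    have expand: "(\<lambda>h. k (norm h) * Q x h) = (\<lambda>h. k (norm h) * (w x \<bullet> h / norm h)\<^sup>2 + k (norm h) * \<epsilon>)"
      by (simp add: Q_def distrib_left)
    have int: "integrable lebesgue (\<lambda>h. k (norm h) * Q x h)"
      unfolding expand using mom(1) k(1) by simp
    have "(LINT h|lebesgue. k (norm h) * Q x h) = (norm (w x))\<^sup>2 + DIM('a) * \<epsilon>"
      unfolding expand using mom k(1,2) by simp
    then have val: "(\<integral>\<^sup>+h. ennreal (k (norm h) * Q x h) \<partial>lebesgue) = ennreal ((norm (w x))\<^sup>2 + DIM('a) * \<epsilon>)"
      using int k(3) Q0 by (subst nn_integral_eq_integral) auto
    have "(\<integral>\<^sup>+h. a' h * ennreal (Q x h) \<partial>lborel) = (\<integral>\<^sup>+h. ennreal (k (norm h) * Q x h) \<partial>lborel)"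
      using a'(2) by (intro nn_integral_cong_AE, eventually_elim) (auto simp: a_def ennreal_mult'' Q0)
    also have "\<dots> = ennreal ((norm (w x))\<^sup>2 + DIM('a) * \<epsilon>)"
      using val by (simp add: nn_integral_completion)
    finally have "(\<integral>\<^sup>+h. a' h * ennreal (Q x h) \<partial>lborel) = ennreal ((norm (w x))\<^sup>2 + DIM('a) * \<epsilon>)" .
    then show ?thesis
      unfolding F_def fst_conv snd_conv
      by (subst nn_integral_cmult, simp add: Q_def)+ simp
  qed
  define I where "I = (\<integral>\<^sup>+x. c' x * ennreal ((norm (w x))\<^sup>2 + DIM('a) * \<epsilon>) \<partial>lborel)"
  have "(\<integral>\<^sup>+z. ennreal (nl_integrand k (\<lambda>x x'. \<gamma> x * \<gamma> x') \<phi> \<phi> z) \<partial>lebesgue_on (S \<times> S))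
      = (\<integral>\<^sup>+z. ennreal (nl_integrand k (\<lambda>x x'. \<gamma> x * \<gamma> x') \<phi> \<phi> z) * indicator (S \<times> S) z \<partial>lebesgue)"
    using SS by (simp add: nn_integral_restrict_space)
  also have "\<dots> \<le> (\<integral>\<^sup>+z. F (fst z, fst z - snd z) + F (snd z, fst z - snd z) \<partial>lebesgue)"
    by (rule nn_integral_mono_AE[OF AE_le])
  also have "\<dots> = (\<integral>\<^sup>+z. F (fst z, fst z - snd z) \<partial>lborel) + (\<integral>\<^sup>+z. F (snd z, fst z - snd z) \<partial>lborel)"
    unfolding nn_integral_completion
    by (rule nn_integral_add; simp add: borel_prod[symmetric])
  also have "\<dots> = ennreal (1/2) * I + ennreal (1/2) * I"
  proof -
    have "(\<integral>\<^sup>+x. ennreal (1/2) * (c' x * ennreal ((norm (w x))\<^sup>2 + DIM('a) * \<epsilon>)) \<partial>lborel) = ennreal (1/2) * I"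
      unfolding I_def by (rule nn_integral_cmult) measurable
    then show ?thesis
      unfolding nn_integral_shear_fst[OF F] nn_integral_shear_snd[OF F] inner by (simp only:)
  qed
  also have "\<dots> = I"
  proof -
    have "ennreal (1/2) + ennreal (1/2) = 1" by (subst ennreal_plus[symmetric]) auto
    then show ?thesis by (simp only: distrib_right[symmetric] mult_1_left)
  qed
  also have "I = (\<integral>\<^sup>+x. c x * ennreal ((norm (w x))\<^sup>2 + DIM('a) * \<epsilon>) \<partial>lborel)"
    unfolding I_def using c'(2) by (intro nn_integral_cong_AE, eventually_elim) simp
  also have "\<dots> = (\<integral>\<^sup>+x. c x * ennreal ((norm (w x))\<^sup>2 + DIM('a) * \<epsilon>) \<partial>lebesgue)"
    by (simp add: nn_integral_completion)
  also have "\<dots> = (\<integral>\<^sup>+x. ennreal ((\<gamma> x)\<^sup>2 * ((norm (w x))\<^sup>2 + DIM('a) * \<epsilon>)) \<partial>lebesgue_on S)"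
    using SS e by (simp add: nn_integral_restrict_space c_def ennreal_mult' mult_ac)
  finally show ?thesis .
qed

section \<open>Function spaces and the non-local compliance\<close>

lemma open_nbhd: "open (nbhd \<Omega> \<delta>)"
  by (auto simp: nbhd_def)

lemma nbhd_mono: "\<delta> \<le> \<delta>' \<Longrightarrow> nbhd \<Omega> \<delta> \<subseteq> nbhd \<Omega> \<delta>'"
  by (force simp: nbhd_def)

lemma subset_nbhd: "\<delta> > 0 \<Longrightarrow> \<Omega> \<subseteq> nbhd \<Omega> \<delta>"
  by (force simp: nbhd_def)

lemma bounded_nbhd:
  fixes \<Omega> :: "'a::euclidean_space set"
  assumes "bounded \<Omega>"
  shows "bounded (nbhd \<Omega> \<delta>)"
proof -
  obtain R where R: "\<And>x. x \<in> \<Omega> \<Longrightarrow> norm x \<le> R" using assms by (auto simp: bounded_iff)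
  have "norm y \<le> R + \<delta>" if y: "y \<in> nbhd \<Omega> \<delta>" for y
  proof -
    obtain x where "x \<in> \<Omega>" "dist x y < \<delta>" using y by (auto simp: nbhd_def)
    then show ?thesis using R[of x] norm_triangle_ineq2[of y x] by (simp add: dist_norm norm_minus_commute)
  qed
  then show ?thesis by (auto simp: bounded_iff)
qed

lemma lmeasurable_nbhd: 
  fixes \<Omega> :: "'a::euclidean_space set"
  assumes "bounded \<Omega>"
  shows "nbhd \<Omega> \<delta> \<in> lmeasurable"
  using bounded_nbhd[OF assms] open_nbhd by (rule lmeasurable_open)

lemma nl_integrand_nonneg:
  assumes "\<And>r. r \<ge> 0 \<Longrightarrow> k r \<ge> 0" "\<And>x. \<gamma> x \<ge> 0"
  shows "nl_integrand k (\<lambda>x x'. \<gamma> x * \<gamma> x') u u z \<ge> 0"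
  using assms by (cases z) (auto simp: nl_integrand_def mult.assoc intro!: mult_nonneg_nonneg)

text \<open>
  The energy is finite because difference quotients of test functions are bounded: this is the estimate
  \<open>nn_integral_nl_integrand_le\<close> with vanishing linearisation \<open>w = 0\<close> and \<open>\<epsilon>\<close> the square of the Lipschitz
  constant.
\<close>

lemma Cc_infty_in_U0_space:
  fixes \<Omega> :: "'a::euclidean_space set"
  assumes \<Omega>: "bounded \<Omega>"
    and k: "integrable lebesgue (\<lambda>x::'a. k (norm x))" "(LINT x::'a|lebesgue. k (norm x)) = DIM('a)"
      "\<And>r. r \<ge> 0 \<Longrightarrow> k r \<ge> 0"
    and \<phi>: "\<phi> \<in> Cc_infty \<Omega>"
  shows "\<phi> \<in> U0_space k \<delta> \<Omega>"
proof -
  let ?S = "nbhd \<Omega> \<delta>"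
  note lm = lmeasurable_nbhd[OF \<Omega>, of \<delta>]
  obtain L where L: "L \<ge> 0" "\<And>x. \<bar>\<phi> x\<bar> \<le> L" "\<And>x. norm (grad \<phi> x) \<le> L"
    by (rule Cc_infty_bounded[OF \<phi>]) blast
  have quad: "(\<phi> x - \<phi> (x - h))\<^sup>2 \<le> (0 \<bullet> h)\<^sup>2 + L\<^sup>2 * (norm h)\<^sup>2" for x h
  proof -
    have "\<bar>\<phi> x - \<phi> (x - h)\<bar> \<le> L * norm h"
      using Lipschitz_of_gradient_bound[OF Cc_infty_has_derivative[OF \<phi>] L(3), of x "x - h"] by simp
    then have "\<bar>\<phi> x - \<phi> (x - h)\<bar>\<^sup>2 \<le> (L * norm h)\<^sup>2" by (rule power_mono) simp
    then show ?thesis by (simp add: power_mult_distrib)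
  qed
  have "(\<integral>\<^sup>+z. ennreal (nl_integrand k (\<lambda>x x'. 1 * 1) \<phi> \<phi> z) \<partial>lebesgue_on (?S \<times> ?S))
      \<le> (\<integral>\<^sup>+x. ennreal (1\<^sup>2 * ((norm (0::'a))\<^sup>2 + DIM('a) * L\<^sup>2)) \<partial>lebesgue_on ?S)"
    by (rule nn_integral_nl_integrand_le[OF open_nbhd k]) (use quad in auto)
  also have "\<dots> < \<infinity>"
    using lm by (simp add: emeasure_restrict_space ennreal_mult_less_top fmeasurable_def less_top del: emeasure_completion)
  finally have fin: "(\<integral>\<^sup>+z. ennreal (nl_integrand k (\<lambda>_ _. 1) \<phi> \<phi> z) \<partial>lebesgue_on (?S \<times> ?S)) < \<infinity>"
    by simp
  have "nl_integrand k (\<lambda>x x'. 1 * 1) \<phi> \<phi> \<in> borel_measurable (lebesgue_on (?S \<times> ?S))"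
    using k(1) measurable_lebesgue_on_continuous[OF continuous_Cc_infty[OF \<phi>]]
    by (intro measurable_nl_integrand) auto
  then have "integrable (lebesgue_on (?S \<times> ?S)) (nl_integrand k (\<lambda>_ _. 1) \<phi> \<phi>)"
    using fin nl_integrand_nonneg[of k "\<lambda>_. 1" \<phi>] k(3) by (intro integrableI_nonneg) auto
  then have "\<phi> \<in> U_space k \<delta> \<Omega>"
    using Cc_infty_L2(1)[OF \<phi> lm] by (simp add: U_space_def)
  moreover have "U_norm k \<delta> \<Omega> (\<lambda>x. \<phi> x - \<phi> x) = 0"
    by (simp add: U_norm_def nl_form_def nl_integrand_def split_beta)
  ultimately show ?thesis
    unfolding U0_space_def using \<phi> by (intro CollectI conjI allI impI bexI[of _ \<phi>]) simp_all
qed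

lemma integrable_nl_integrand_weighted:
  fixes \<Omega> :: "'a::euclidean_space set"
  assumes k: "(\<lambda>x::'a. k (norm x)) \<in> borel_measurable lebesgue" "\<And>r. r \<ge> 0 \<Longrightarrow> k r \<ge> 0"
    and \<gamma>: "\<gamma> \<in> borel_measurable (lebesgue_on (nbhd \<Omega> \<delta>))" "\<And>x. \<gamma> x \<ge> 0"
      "AE x in lebesgue_on (nbhd \<Omega> \<delta>). \<gamma> x \<le> M"
    and v: "v \<in> U_space k \<delta> \<Omega>"
  shows "integrable (lebesgue_on (nbhd \<Omega> \<delta> \<times> nbhd \<Omega> \<delta>)) (nl_integrand k (\<lambda>x x'. \<gamma> x * \<gamma> x') v v)"
proof (rule Bochner_Integration.integrable_bound)
  let ?S = "nbhd \<Omega> \<delta>"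
  have SS: "?S \<times> ?S \<in> sets lebesgue" "?S \<in> sets lebesgue" using open_nbhd[of \<Omega> \<delta>] open_Times[OF open_nbhd[of \<Omega> \<delta>] open_nbhd[of \<Omega> \<delta>]] by auto
  show "integrable (lebesgue_on (?S \<times> ?S)) (\<lambda>z. M * M * nl_integrand k (\<lambda>_ _. 1) v v z)"
    using v by (auto simp: U_space_def)
  show "nl_integrand k (\<lambda>x x'. \<gamma> x * \<gamma> x') v v \<in> borel_measurable (lebesgue_on (?S \<times> ?S))"
    using k \<gamma>(1) v by (intro measurable_nl_integrand) (auto simp: U_space_def L2_def)
  have ae: "AE x in lebesgue. x \<in> ?S \<longrightarrow> \<gamma> x \<le> M"
    using \<gamma>(3) SS by (simp add: AE_restrict_space_iff)
  have "AE z::'a \<times> 'a in lebesgue. fst z \<in> ?S \<longrightarrow> \<gamma> (fst z) \<le> M"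
    by (rule AE_lebesgue_pullback[OF AE_fst_notin ae])
  moreover have "AE z::'a \<times> 'a in lebesgue. snd z \<in> ?S \<longrightarrow> \<gamma> (snd z) \<le> M"
    by (rule AE_lebesgue_pullback[OF AE_snd_notin ae])
  ultimately have "AE z in lebesgue. z \<in> ?S \<times> ?S \<longrightarrow> norm (nl_integrand k (\<lambda>x x'. \<gamma> x * \<gamma> x') v v z)
      \<le> norm (M * M * nl_integrand k (\<lambda>_ _. 1) v v z)"
  proof eventually_elim
    fix z assume z: "fst z \<in> ?S \<longrightarrow> \<gamma> (fst z) \<le> M" "snd z \<in> ?S \<longrightarrow> \<gamma> (snd z) \<le> M"
    show "z \<in> ?S \<times> ?S \<longrightarrow> norm (nl_integrand k (\<lambda>x x'. \<gamma> x * \<gamma> x') v v z)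
      \<le> norm (M * M * nl_integrand k (\<lambda>_ _. 1) v v z)"
    proof
      assume "z \<in> ?S \<times> ?S"
      then have "\<gamma> (fst z) * \<gamma> (snd z) \<le> M * M"
        using z \<gamma>(2) by (intro mult_mono) (auto intro: order_trans)
      moreover have n: "nl_integrand k (\<lambda>_ _. 1) v v z \<ge> 0"
        using nl_integrand_nonneg[of k "\<lambda>_. 1" v z] k(2) by simp
      ultimately have "\<gamma> (fst z) * \<gamma> (snd z) * nl_integrand k (\<lambda>_ _. 1) v v z \<le> M * M * nl_integrand k (\<lambda>_ _. 1) v v z"
        by (rule mult_right_mono)
      moreover have "nl_integrand k (\<lambda>x x'. \<gamma> x * \<gamma> x') v v z = \<gamma> (fst z) * \<gamma> (snd z) * nl_integrand k (\<lambda>_ _. 1) v v z"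
        by (simp add: nl_integrand_def split_beta mult_ac)
      moreover have "nl_integrand k (\<lambda>x x'. \<gamma> x * \<gamma> x') v v z \<ge> 0"
        by (rule nl_integrand_nonneg[OF k(2) \<gamma>(2)])
      ultimately show "norm (nl_integrand k (\<lambda>x x'. \<gamma> x * \<gamma> x') v v z) \<le> norm (M * M * nl_integrand k (\<lambda>_ _. 1) v v z)"
        by simp
    qed
  qed
  then show "AE z in lebesgue_on (?S \<times> ?S). norm (nl_integrand k (\<lambda>x x'. \<gamma> x * \<gamma> x') v v z)
      \<le> norm (M * M * nl_integrand k (\<lambda>_ _. 1) v v z)"
    using SS by (simp add: AE_restrict_space_iff)
qed

text \<open>
  This is \<open>a(u - v, u - v) \<ge> 0\<close> rewritten with \<open>a(u, u) = \<ell>(u)\<close> and \<open>a(u, v) = \<ell>(v)\<close>.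
\<close>

lemma nl_compliance_ge:
  fixes \<Omega> :: "'a::euclidean_space set"
  assumes k: "(\<lambda>x::'a. k (norm x)) \<in> borel_measurable lebesgue" "\<And>r. r \<ge> 0 \<Longrightarrow> k r \<ge> 0"
    and \<gamma>: "\<gamma> \<in> borel_measurable (lebesgue_on (nbhd \<Omega> \<delta>))" "\<And>x. \<gamma> x \<ge> 0"
      "AE x in lebesgue_on (nbhd \<Omega> \<delta>). \<gamma> x \<le> M"
    and u: "nl_solution k \<delta> \<Omega> f (\<lambda>x x'. \<gamma> x * \<gamma> x') u" and v: "v \<in> U0_space k \<delta> \<Omega>"
  shows "load \<Omega> f u \<ge> 2 * load \<Omega> f v - nl_form k \<delta> \<Omega> (\<lambda>x x'. \<gamma> x * \<gamma> x') v v"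
proof -
  let ?\<kappa> = "\<lambda>x x'. \<gamma> x * \<gamma> x'" and ?M = "lebesgue_on (nbhd \<Omega> \<delta> \<times> nbhd \<Omega> \<delta>)"
  have uU: "u \<in> U0_space k \<delta> \<Omega>" using u by (simp add: nl_solution_def)
  have uu: "nl_form k \<delta> \<Omega> ?\<kappa> u u = load \<Omega> f u" and uv: "nl_form k \<delta> \<Omega> ?\<kappa> u v = load \<Omega> f v"
    using u v uU by (auto simp: nl_solution_def)
  have int: "integrable ?M (nl_integrand k ?\<kappa> u u)" "integrable ?M (nl_integrand k ?\<kappa> v v)"
    using integrable_nl_integrand_weighted[OF k \<gamma>] uU v by (auto simp: U0_space_def)
  have young: "2 * nl_integrand k ?\<kappa> u v z \<le> nl_integrand k ?\<kappa> u u z + nl_integrand k ?\<kappa> v v z" for z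
  proof -
    obtain x y where z: "z = (x, y)" by (cases z)
    define m where "m = \<gamma> x * \<gamma> y * k (norm (x - y))"
    define a where "a = (u x - u y) / norm (x - y)"
    define b where "b = (v x - v y) / norm (x - y)"
    have "m \<ge> 0" using k(2) \<gamma>(2) by (simp add: m_def)
    then have "m * (2 * a * b) \<le> m * (a\<^sup>2 + b\<^sup>2)" by (intro mult_left_mono sum_squares_bound)
    then have "2 * (m * a * b) \<le> m * a * a + m * b * b" by (simp add: power2_eq_square algebra_simps)
    then show ?thesis by (simp add: z nl_integrand_def m_def a_def b_def)
  qed
  have "2 * nl_form k \<delta> \<Omega> ?\<kappa> u v \<le> nl_form k \<delta> \<Omega> ?\<kappa> u u + nl_form k \<delta> \<Omega> ?\<kappa> v v"
  proof (cases "integrable ?M (nl_integrand k ?\<kappa> u v)")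
    case True
    have "integral\<^sup>L ?M (\<lambda>z. 2 * nl_integrand k ?\<kappa> u v z) \<le> integral\<^sup>L ?M (\<lambda>z. nl_integrand k ?\<kappa> u u z + nl_integrand k ?\<kappa> v v z)"
      using True int young by (intro integral_mono) auto
    then show ?thesis using True int by (simp add: nl_form_def)
  next
    \<comment> \<open>The integral of a non-integrable function is \<open>0\<close> by convention.\<close>
    case False
    have "nl_form k \<delta> \<Omega> ?\<kappa> w w \<ge> 0" for w
      unfolding nl_form_def
      by (rule Bochner_Integration.integral_nonneg) (rule nl_integrand_nonneg[OF k(2) \<gamma>(2)])
    then have "nl_form k \<delta> \<Omega> ?\<kappa> u u + nl_form k \<delta> \<Omega> ?\<kappa> v v \<ge> 0" by (intro add_nonneg_nonneg)
    then show ?thesis using False by (simp add: nl_form_def not_integrable_integral_eq)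
  qed
  then show ?thesis using uu uv by simp
qed

text \<open>
  The right-hand side is taken on the larger neighbourhood, which does not depend on \<open>\<delta>\<close>, so that it
  can be tested against weak* convergence there.
\<close>

lemma nl_form_le_local:
  fixes \<Omega> :: "'a::euclidean_space set" and \<epsilon> M :: real
  assumes \<Omega>: "bounded \<Omega>" and \<delta>: "\<delta> \<le> \<delta>0"
    and k: "integrable lebesgue (\<lambda>x::'a. k (norm x))" "(LINT x::'a|lebesgue. k (norm x)) = DIM('a)"
      "\<And>r. r \<ge> 0 \<Longrightarrow> k r \<ge> 0"
    and quad: "\<And>x h. k (norm h) \<noteq> 0 \<Longrightarrow> (\<phi> x - \<phi> (x - h))\<^sup>2 \<le> (w x \<bullet> h)\<^sup>2 + \<epsilon> * (norm h)\<^sup>2"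
    and e: "\<epsilon> \<ge> 0" and w: "continuous_on UNIV w" "\<And>x. norm (w x) \<le> L"
    and \<gamma>: "\<gamma> \<in> borel_measurable (lebesgue_on (nbhd \<Omega> \<delta>0))" "\<And>x. \<gamma> x \<ge> 0"
      "AE x in lebesgue_on (nbhd \<Omega> \<delta>0). \<gamma> x \<le> M"
  shows "nl_form k \<delta> \<Omega> (\<lambda>x x'. \<gamma> x * \<gamma> x') \<phi> \<phi>
      \<le> (LINT x|lebesgue_on (nbhd \<Omega> \<delta>0). (\<gamma> x)\<^sup>2 * (norm (w x))\<^sup>2)
        + M\<^sup>2 * DIM('a) * \<epsilon> * measure lebesgue (nbhd \<Omega> \<delta>0)"
proof -
  let ?S = "nbhd \<Omega> \<delta>0"
  note lm = lmeasurable_nbhd[OF \<Omega>, of \<delta>0]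
  have sub: "nbhd \<Omega> \<delta> \<subseteq> ?S" by (rule nbhd_mono[OF \<delta>])
  have [measurable]: "\<gamma> \<in> borel_measurable (lebesgue_on ?S)" by fact
  have [measurable]: "w \<in> borel_measurable (lebesgue_on ?S)" by (rule measurable_lebesgue_on_continuous[OF w(1)])
  have g2: "AE x in lebesgue_on ?S. (\<gamma> x)\<^sup>2 \<le> M\<^sup>2"
    using \<gamma>(3) by eventually_elim (auto intro!: power_mono \<gamma>)
  have i1: "integrable (lebesgue_on ?S) (\<lambda>x. (\<gamma> x)\<^sup>2)"
    using g2 by (intro integrable_lebesgue_on_bounded[OF lm, of _ "M\<^sup>2"]) auto
  have i2: "integrable (lebesgue_on ?S) (\<lambda>x. (\<gamma> x)\<^sup>2 * (norm (w x))\<^sup>2)"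
  proof (rule integrable_lebesgue_on_bounded[OF lm, of _ "M\<^sup>2 * L\<^sup>2"])
    show "AE x in lebesgue_on ?S. norm ((\<gamma> x)\<^sup>2 * (norm (w x))\<^sup>2) \<le> M\<^sup>2 * L\<^sup>2"
      using g2 by eventually_elim (auto intro!: mult_mono power_mono w(2))
  qed measurable
  define g where "g x = (\<gamma> x)\<^sup>2 * ((norm (w x))\<^sup>2 + DIM('a) * \<epsilon>)" for x
  have g0: "g x \<ge> 0" for x using e by (simp add: g_def)
  have geq: "g = (\<lambda>x. (\<gamma> x)\<^sup>2 * (norm (w x))\<^sup>2 + (\<gamma> x)\<^sup>2 * (DIM('a) * \<epsilon>))"
    by (simp add: g_def fun_eq_iff distrib_left)
  have ig: "integrable (lebesgue_on ?S) g" unfolding geq using i1 i2 by simp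
  have "\<gamma> \<in> borel_measurable (lebesgue_on (nbhd \<Omega> \<delta>))"
    using measurable_restrict_mono[OF \<gamma>(1) sub] .
  then have "(\<integral>\<^sup>+z. ennreal (nl_integrand k (\<lambda>x x'. \<gamma> x * \<gamma> x') \<phi> \<phi> z) \<partial>lebesgue_on (nbhd \<Omega> \<delta> \<times> nbhd \<Omega> \<delta>))
      \<le> (\<integral>\<^sup>+x. ennreal (g x) \<partial>lebesgue_on (nbhd \<Omega> \<delta>))"
    unfolding g_def by (intro nn_integral_nl_integrand_le[OF open_nbhd k quad e w(1)] \<gamma>(2))
  also have "\<dots> \<le> (\<integral>\<^sup>+x. ennreal (g x) \<partial>lebesgue_on ?S)"
    using sub open_nbhd[of \<Omega>] by (auto simp: nn_integral_restrict_space intro!: nn_integral_mono split: split_indicator)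
  also have "\<dots> = ennreal (integral\<^sup>L (lebesgue_on ?S) g)"
    using ig g0 by (intro nn_integral_eq_integral) auto
  finally have "nl_form k \<delta> \<Omega> (\<lambda>x x'. \<gamma> x * \<gamma> x') \<phi> \<phi> \<le> integral\<^sup>L (lebesgue_on ?S) g"
    unfolding nl_form_def by (intro integral_real_bounded Bochner_Integration.integral_nonneg g0)
  also have "\<dots> = (LINT x|lebesgue_on ?S. (\<gamma> x)\<^sup>2 * (norm (w x))\<^sup>2) + (LINT x|lebesgue_on ?S. (\<gamma> x)\<^sup>2) * (DIM('a) * \<epsilon>)"
    unfolding geq using i1 i2 by simp
  also have "(LINT x|lebesgue_on ?S. (\<gamma> x)\<^sup>2) * (DIM('a) * \<epsilon>) \<le> (M\<^sup>2 * measure lebesgue ?S) * (DIM('a) * \<epsilon>)"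
  proof (rule mult_right_mono)
    have "(LINT x|lebesgue_on ?S. (\<gamma> x)\<^sup>2) \<le> (LINT x|lebesgue_on ?S. M\<^sup>2)"
      using g2 lm by (intro integral_mono_AE i1) (auto simp: finite_measure_lebesgue_on finite_measure.integrable_const)
    also have "\<dots> = M\<^sup>2 * measure lebesgue ?S"
      using lm by (simp add: measure_restrict_space mult.commute)
    finally show "(LINT x|lebesgue_on ?S. (\<gamma> x)\<^sup>2) \<le> M\<^sup>2 * measure lebesgue ?S" .
  qed (use e in simp)
  finally show ?thesis by (simp add: mult_ac)
qed

section \<open>Lower semicontinuity of the compliance\<close>

lemma liminf_real_ge:
  fixes c :: "nat \<Rightarrow> real"
  assumes "\<And>\<eta>. \<eta> > 0 \<Longrightarrow> \<forall>\<^sub>F j in sequentially. l - \<eta> \<le> c j"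
  shows "ereal l \<le> liminf (\<lambda>j. ereal (c j))"
proof (rule ereal_le_epsilon2)
  fix \<eta> :: real assume "\<eta> > 0"
  then have "ereal (l - \<eta>) \<le> liminf (\<lambda>j. ereal (c j))"
    using assms by (intro Liminf_bounded) simp
  then have "ereal (l - \<eta>) + ereal \<eta> \<le> liminf (\<lambda>j. ereal (c j)) + ereal \<eta>"
    by (rule add_right_mono)
  then show "ereal l \<le> liminf (\<lambda>j. ereal (c j)) + ereal \<eta>" by simp
qed

theorem proposition8:
  fixes \<Omega> :: "'a::euclidean_space set"
    and A :: "real \<Rightarrow> real \<Rightarrow> real"
    and f :: "'a \<Rightarrow> real"
    and p \<delta>\<^sub>0 \<rho>_lo \<rho>_hi :: real
    and \<rho>\<^sub>\<delta> :: "real \<Rightarrow> 'a \<Rightarrow> real" and \<rho> :: "'a \<Rightarrow> real"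
    and u\<^sub>\<delta> :: "real \<Rightarrow> 'a \<Rightarrow> real" and u :: "'a \<Rightarrow> real"
    and d :: "nat \<Rightarrow> real"
  assumes dim: "DIM('a) \<ge> 2"
    and \<Omega>: "open \<Omega>" "bounded \<Omega>" "connected \<Omega>"
    and bounds: "0 < \<rho>_lo" "\<rho>_lo < \<rho>_hi"
    and A_nonneg: "\<And>\<delta> r. \<delta> > 0 \<Longrightarrow> r \<ge> 0 \<Longrightarrow> A \<delta> r \<ge> 0"
    and A_integrable: "\<And>\<delta>. \<delta> > 0 \<Longrightarrow> integrable lebesgue (\<lambda>x::'a. A \<delta> (norm x))"
    and A_normalized: "\<And>\<delta>. \<delta> > 0 \<Longrightarrow> (1 / real DIM('a)) * (LINT x::'a|lebesgue. A \<delta> (norm x)) = 1"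
    and A_support: "\<And>\<delta>. \<delta> > 0 \<Longrightarrow> closure {x::'a. A \<delta> (norm x) \<noteq> 0} \<subseteq> ball 0 \<delta>"
    and A_lower: "\<exists>s\<in>{0<..<1}. \<exists>c. \<forall>\<delta>>0. c \<delta> > 0 \<and>
        (\<forall>x \<in> ball (0::'a) (\<delta> / 2) - {0}.
           A \<delta> (norm x) \<ge> c \<delta> * norm x powr (- (real DIM('a) + 2 * s - 2)))"
    and p: "p \<ge> 1"
    and \<delta>\<^sub>0: "\<delta>\<^sub>0 > 0"
    and f: "f \<in> L2 \<Omega>"
    and \<rho>\<^sub>\<delta>: "\<And>\<delta>. \<delta> \<in> {0<..<\<delta>\<^sub>0} \<Longrightarrow> \<rho>\<^sub>\<delta> \<delta> \<in> Linf (nbhd \<Omega> \<delta>\<^sub>0)"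
      "\<And>\<delta>. \<delta> \<in> {0<..<\<delta>\<^sub>0} \<Longrightarrow> AE x in lebesgue_on (nbhd \<Omega> \<delta>\<^sub>0). \<rho>_lo \<le> \<rho>\<^sub>\<delta> \<delta> x \<and> \<rho>\<^sub>\<delta> \<delta> x \<le> \<rho>_hi"
    and \<rho>: "\<rho> \<in> Linf (nbhd \<Omega> \<delta>\<^sub>0)"
      "AE x in lebesgue_on (nbhd \<Omega> \<delta>\<^sub>0). \<rho>_lo \<le> \<rho> x \<and> \<rho> x \<le> \<rho>_hi"
    and d: "\<And>j. d j \<in> {0<..<\<delta>\<^sub>0}" "d \<longlonglongrightarrow> 0"
    and weak_star: "weak_star_tendsto (nbhd \<Omega> \<delta>\<^sub>0)
        (\<lambda>j x. \<rho>\<^sub>\<delta> (d j) x powr p) (\<lambda>x. \<rho> x powr p) sequentially"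
    and u\<^sub>\<delta>: "\<And>\<delta>. \<delta> \<in> {0<..<\<delta>\<^sub>0} \<Longrightarrow>
        nl_solution (A \<delta>) \<delta> \<Omega> f (\<lambda>x x'. \<rho>\<^sub>\<delta> \<delta> x powr (p / 2) * \<rho>\<^sub>\<delta> \<delta> x' powr (p / 2)) (u\<^sub>\<delta> \<delta>)"
    and u: "loc_solution \<Omega> f (\<lambda>x. \<rho> x powr p) u"
  shows "liminf (\<lambda>j. ereal (load \<Omega> f (u\<^sub>\<delta> (d j)))) \<ge> ereal (load \<Omega> f u)"
proof -
  let ?S = "nbhd \<Omega> \<delta>\<^sub>0"
  note lm = lmeasurable_nbhd[OF \<Omega>(2), of \<delta>\<^sub>0]
  define M where "M = \<rho>_hi powr (p / 2)"
  have M2: "M\<^sup>2 = \<rho>_hi powr p" by (simp add: M_def power2_eq_square flip: powr_add)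
  have meas_\<rho>: "(\<lambda>x. \<rho> x powr p) \<in> borel_measurable (lebesgue_on \<Omega>)"
  proof -
    have "\<rho> \<in> borel_measurable (lebesgue_on \<Omega>)"
      using measurable_restrict_mono[OF _ subset_nbhd[OF \<delta>\<^sub>0]] \<rho>(1) by (auto simp: Linf_def)
    then show ?thesis by measurable
  qed
  have bnd_\<rho>: "AE x in lebesgue_on \<Omega>. \<bar>\<rho> x powr p\<bar> \<le> \<rho>_hi powr p"
  proof -
    have "AE x in lebesgue. x \<in> ?S \<longrightarrow> \<rho>_lo \<le> \<rho> x \<and> \<rho> x \<le> \<rho>_hi"
      using \<rho>(2) lm by (subst (asm) AE_restrict_space_iff) (auto simp: fmeasurableD)
    then have "AE x in lebesgue. x \<in> \<Omega> \<longrightarrow> \<bar>\<rho> x powr p\<bar> \<le> \<rho>_hi powr p"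
      by eventually_elim (use subset_nbhd[OF \<delta>\<^sub>0, of \<Omega>] bounds p in \<open>auto intro!: powr_mono2\<close>)
    then show ?thesis
      using \<Omega>(1) by (simp add: AE_restrict_space_iff)
  qed
  show ?thesis
  proof (rule liminf_real_ge)
    fix \<eta> :: real assume \<eta>: "\<eta> > 0"
    \<comment> \<open>One third of \<open>\<eta>\<close> each for the choice of \<open>\<phi>\<close>, the linearisation error and the weak* limit.\<close>
    obtain \<phi> where \<phi>: "\<phi> \<in> Cc_infty \<Omega>"
      and \<phi>u: "load \<Omega> f u - \<eta> / 3 \<le> 2 * load \<Omega> f \<phi> - (LINT x|lebesgue_on \<Omega>. \<rho> x powr p * (norm (grad \<phi> x))\<^sup>2)"
      using local_compliance_approx[OF \<Omega>(1,2) u meas_\<rho> bnd_\<rho>, of "\<eta> / 3"] \<eta> by auto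
    obtain L where L: "\<And>x. norm (grad \<phi> x) \<le> L"
      by (rule Cc_infty_bounded[OF \<phi>]) blast
    define C where "C = M\<^sup>2 * DIM('a) * measure lebesgue ?S"
    have C: "C \<ge> 0" by (simp add: C_def)
    define \<epsilon> where "\<epsilon> = \<eta> / 3 / (C + 1)"
    have \<epsilon>: "\<epsilon> > 0" "C * \<epsilon> \<le> \<eta> / 3"
    proof -
      show "\<epsilon> > 0" using \<eta> C by (simp add: \<epsilon>_def)
      then have "C * \<epsilon> \<le> (C + 1) * \<epsilon>" by simp
      also have "\<dots> = \<eta> / 3"
        unfolding \<epsilon>_def using C by (subst times_divide_eq_right, subst nonzero_mult_div_cancel_left) auto
      finally show "C * \<epsilon> \<le> \<eta> / 3" .
    qed
    obtain r where r: "r > 0"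
      and quad: "\<And>x h. norm h < r \<Longrightarrow> (\<phi> x - \<phi> (x - h))\<^sup>2 \<le> (grad \<phi> x \<bullet> h)\<^sup>2 + \<epsilon> * (norm h)\<^sup>2"
      by (rule Cc_infty_quadratic_bound[OF \<phi> \<epsilon>(1)]) blast
    define E where "E \<delta> = (LINT x|lebesgue_on ?S. \<rho>\<^sub>\<delta> \<delta> x powr p * (norm (grad \<phi> x))\<^sup>2)" for \<delta>
    have below: "2 * load \<Omega> f \<phi> - E \<delta> - \<eta> / 3 \<le> load \<Omega> f (u\<^sub>\<delta> \<delta>)"
      if \<delta>: "\<delta> \<in> {0<..<\<delta>\<^sub>0}" "\<delta> < r" for \<delta>
    proof -
      have \<delta>0: "\<delta> > 0" and \<delta>le: "\<delta> \<le> \<delta>\<^sub>0" using \<delta> by auto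
      define \<gamma> where "\<gamma> x = \<rho>\<^sub>\<delta> \<delta> x powr (p / 2)" for x
      have \<gamma>2: "(\<gamma> x)\<^sup>2 = \<rho>\<^sub>\<delta> \<delta> x powr p" for x
        by (simp add: \<gamma>_def power2_eq_square flip: powr_add)
      have "\<rho>\<^sub>\<delta> \<delta> \<in> borel_measurable (lebesgue_on ?S)" using \<rho>\<^sub>\<delta>(1)[OF \<delta>(1)] by (simp add: Linf_def)
      then have \<gamma>m: "\<gamma> \<in> borel_measurable (lebesgue_on ?S)" unfolding \<gamma>_def[abs_def] by measurable
      have \<gamma>0: "\<gamma> x \<ge> 0" for x by (simp add: \<gamma>_def)
      have \<gamma>M: "AE x in lebesgue_on ?S. \<gamma> x \<le> M"
        using \<rho>\<^sub>\<delta>(2)[OF \<delta>(1)] by eventually_elim (use bounds p in \<open>auto simp: \<gamma>_def M_def intro!: powr_mono2\<close>)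
      have sub: "nbhd \<Omega> \<delta> \<subseteq> ?S" by (rule nbhd_mono[OF \<delta>le])
      have \<gamma>m': "\<gamma> \<in> borel_measurable (lebesgue_on (nbhd \<Omega> \<delta>))"
        using measurable_restrict_mono[OF \<gamma>m sub] .
      have \<gamma>M': "AE x in lebesgue_on (nbhd \<Omega> \<delta>). \<gamma> x \<le> M"
      proof -
        have "AE x in lebesgue. x \<in> ?S \<longrightarrow> \<gamma> x \<le> M"
          using \<gamma>M lm by (simp add: AE_restrict_space_iff fmeasurableD)
        then have "AE x in lebesgue. x \<in> nbhd \<Omega> \<delta> \<longrightarrow> \<gamma> x \<le> M"
          by eventually_elim (use sub in auto)
        then show ?thesis using open_nbhd[of \<Omega> \<delta>] by (simp add: AE_restrict_space_iff)
      qed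
      have norm1: "(LINT x::'a|lebesgue. A \<delta> (norm x)) = DIM('a)"
        using A_normalized[OF \<delta>0] by simp
      have supp: "norm h < \<delta>" if "A \<delta> (norm h) \<noteq> 0" for h :: 'a
        using A_support[OF \<delta>0] closure_subset[of "{x::'a. A \<delta> (norm x) \<noteq> 0}"] that by auto
      have "nl_form (A \<delta>) \<delta> \<Omega> (\<lambda>x x'. \<gamma> x * \<gamma> x') \<phi> \<phi>
          \<le> (LINT x|lebesgue_on ?S. (\<gamma> x)\<^sup>2 * (norm (grad \<phi> x))\<^sup>2)
            + M\<^sup>2 * DIM('a) * \<epsilon> * measure lebesgue ?S"
      proof (rule nl_form_le_local[OF \<Omega>(2) \<delta>le A_integrable[OF \<delta>0] norm1 A_nonneg[OF \<delta>0] _ _ continuous_grad[OF \<phi>] L \<gamma>m \<gamma>0 \<gamma>M])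
        fix x h :: 'a assume "A \<delta> (norm h) \<noteq> 0"
        then show "(\<phi> x - \<phi> (x - h))\<^sup>2 \<le> (grad \<phi> x \<bullet> h)\<^sup>2 + \<epsilon> * (norm h)\<^sup>2"
          using supp[of h] \<delta>(2) by (intro quad) simp
      qed (use \<epsilon> in auto)
      also have "\<dots> = E \<delta> + C * \<epsilon>" by (simp add: E_def \<gamma>2 C_def mult_ac)
      finally have "nl_form (A \<delta>) \<delta> \<Omega> (\<lambda>x x'. \<gamma> x * \<gamma> x') \<phi> \<phi> \<le> E \<delta> + \<eta> / 3" using \<epsilon>(2) by simp
      moreover have "load \<Omega> f (u\<^sub>\<delta> \<delta>) \<ge> 2 * load \<Omega> f \<phi> - nl_form (A \<delta>) \<delta> \<Omega> (\<lambda>x x'. \<gamma> x * \<gamma> x') \<phi> \<phi>"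
      proof (rule nl_compliance_ge[OF _ A_nonneg[OF \<delta>0] \<gamma>m' \<gamma>0 \<gamma>M'])
        show "(\<lambda>x::'a. A \<delta> (norm x)) \<in> borel_measurable lebesgue" using A_integrable[OF \<delta>0] by simp
        show "nl_solution (A \<delta>) \<delta> \<Omega> f (\<lambda>x x'. \<gamma> x * \<gamma> x') (u\<^sub>\<delta> \<delta>)"
          unfolding \<gamma>_def by (rule u\<^sub>\<delta>[OF \<delta>(1)])
        show "\<phi> \<in> U0_space (A \<delta>) \<delta> \<Omega>"
          by (rule Cc_infty_in_U0_space[OF \<Omega>(2) A_integrable[OF \<delta>0] norm1 A_nonneg[OF \<delta>0] \<phi>])
      qed
      ultimately show ?thesis by simp
    qed
    have test: "integrable (lebesgue_on ?S) (\<lambda>x. (norm (grad \<phi> x))\<^sup>2)"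
      using Cc_infty_L2(2)[OF \<phi> lm] by (simp add: L2_def)
    have "(\<lambda>j. E (d j)) \<longlonglongrightarrow> (LINT x|lebesgue_on ?S. \<rho> x powr p * (norm (grad \<phi> x))\<^sup>2)"
      using weak_star test unfolding weak_star_tendsto_def E_def by blast
    also have "(LINT x|lebesgue_on ?S. \<rho> x powr p * (norm (grad \<phi> x))\<^sup>2)
        = (LINT x|lebesgue_on \<Omega>. \<rho> x powr p * (norm (grad \<phi> x))\<^sup>2)" (is "_ = ?E0")
    proof -
      obtain K where K: "K \<subseteq> \<Omega>" "\<And>x. x \<notin> K \<Longrightarrow> grad \<phi> x = 0"
        by (rule Cc_infty_support[OF \<phi>]) blast
      have z: "\<rho> x powr p * (norm (grad \<phi> x))\<^sup>2 = 0" if "x \<notin> \<Omega>" for x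
      proof -
        have "x \<notin> K" using K(1) that by blast
        then show ?thesis by (simp add: K(2))
      qed
      have "(LINT x|lebesgue_on ?S. \<rho> x powr p * (norm (grad \<phi> x))\<^sup>2) = (LINT x|lebesgue. \<rho> x powr p * (norm (grad \<phi> x))\<^sup>2)"
        using lm z subset_nbhd[OF \<delta>\<^sub>0, of \<Omega>] by (intro integral_lebesgue_on_support) (auto simp: fmeasurableD)
      also have "\<dots> = ?E0"
        using \<Omega>(1) z by (intro integral_lebesgue_on_support[symmetric]) auto
      finally show ?thesis .
    qed
    finally have "\<forall>\<^sub>F j in sequentially. E (d j) < ?E0 + \<eta> / 3"
      using \<eta> by (intro order_tendstoD(2)[of _ ?E0]) auto
    moreover have "\<forall>\<^sub>F j in sequentially. d j < r"
      using d(2) r by (rule order_tendstoD(2))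
    ultimately show "\<forall>\<^sub>F j in sequentially. load \<Omega> f u - \<eta> \<le> load \<Omega> f (u\<^sub>\<delta> (d j))"
    proof eventually_elim
      case (elim j)
      then show ?case using below[OF d(1) elim(2)] \<phi>u by linarith
    qed
  qed
qed

end
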